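(* The Birkhoff normal form of the (non-dimensionalised) Euler top Hamiltonian $H$ (defined in the context) at the hyperbolic equilibrium point $(q,p)=(0,0)$ is $$\begin{aligned}H^*(J)=\;&J-\tfrac{\kappa}{4}J^2-\tfrac{\kappa^2+4}{16}J^3-\tfrac{5\kappa(\kappa^2+4)}{128}J^4-\tfrac{3(\kappa^2+4)(11\kappa^2+12)}{1024}J^5\\&-\tfrac{7\kappa(\kappa^2+4)(9\kappa^2+20)}{2048}J^6-\tfrac{(\kappa^2+4)(527\kappa^4+1776\kappa^2+720)}{16384}J^7+\mathcal{O}(J^8),\end{aligned}$$ where $J=qp$ in the new (normal form) canonical variables.
   Context: The Euler top has moments of inertia $0<\Theta_1<\Theta_2<\Theta_3$ satisfying the triangle inequalities. Set $\rho:=\sqrt{\frac{\Theta_1(\Theta_3-\Theta_2)}{\Theta_3(\Theta_2-\Theta_1)}}$ and $\kappa:=\rho-\rho^{-1}$. In canonical variables $q=\mathrm{Arg}(L_2+\mathrm{i}L_1)$, $p=L_3/\ell$ on the sphere $\|\boldsymbol L\|=\ell$, after shifting the energy to vanish at the unstable equilibrium and dividing by $\lambda\ell$, where $\lambda=\frac{\ell}{\Theta_2}\sqrt{\frac{(\Theta_2-\Theta_1)(\Theta_3-\Theta_2)}{\Theta_1\Theta_3}}$, the Hamiltonian is $$H(q,p)=\tfrac12\left(-p^2(\rho+\rho^{-1}\sin^2q)+\rho^{-1}\sin^2q\right),$$ with standard symplectic form $dq\wedge dp$. The point $(0,0)$ is the hyperbolic equilibrium (rotation about the axis of the middle moment of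 inertia). The Birkhoff normal form of $H$ at $(0,0)$ is the power series $H^*$ in one variable such that a (formal) symplectic change of variables fixing the origin transforms $H$ into $H^*(qp)$. It is normalised so that its leading term is $+J$ (the sign convention that the quadratic part is $+qp$). *)

theory Defs
  imports "HOL-Analysis.Analysis"
begin

definition euler_rho :: "real \<Rightarrow> real \<Rightarrow> real \<Rightarrow> real" where
  "euler_rho \<Theta>1 \<Theta>2 \<Theta>3 = sqrt ((\<Theta>1 * (\<Theta>3 - \<Theta>2)) / (\<Theta>3 * (\<Theta>2 - \<Theta>1)))"

definition euler_hamiltonian :: "real \<Rightarrow> real \<Rightarrow> real \<Rightarrow> real" where
  "euler_hamiltonian \<rho> q p =
     1/2 * (- (p^2) * (\<rho> + inverse \<rho> * (sin q)^2) + inverse \<rho> * (sin q)^2)"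

text \<open>
  A formal power series in two variables \<open>(q, p)\<close> is an element of \<^typ>\<open>real fps fps\<close>:
  the outer variable is \<open>q\<close> and the inner one is \<open>p\<close>, so that
  \<open>fps_nth (fps_nth F i) j\<close> is the coefficient of \<open>q^i p^j\<close>.
\<close>

abbreviation coeff2 :: "real fps fps \<Rightarrow> nat \<Rightarrow> nat \<Rightarrow> real" where
  "coeff2 F i j \<equiv> fps_nth (fps_nth F i) j"

text \<open>Taylor series at the origin of a smooth function of \<open>(q, p)\<close>.\<close>

definition taylor2 :: "(real \<Rightarrow> real \<Rightarrow> real) \<Rightarrow> real fps fps" where
  "taylor2 f = Abs_fps (\<lambda>i. Abs_fps (\<lambda>j.
     (deriv ^^ i) (\<lambda>q. (deriv ^^ j) (\<lambda>p. f q p) 0) 0 / (fact i * fact j)))"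

text \<open>
  The substitution \<open>F(A(q,p), B(q,p))\<close>, meaningful when \<open>A\<close> and \<open>B\<close> have zero constant term:
  then \<open>A^i B^j\<close> only has terms of total degree at least \<open>i + j\<close>, so the terms with
  \<open>i > m + n\<close> or \<open>j > m + n\<close>, which are left out of the sum, do not contribute to the
  coefficient of \<open>q^m p^n\<close>.
\<close>

definition compose2 :: "real fps fps \<Rightarrow> real fps fps \<Rightarrow> real fps fps \<Rightarrow> real fps fps" where
  "compose2 F A B = Abs_fps (\<lambda>m. Abs_fps (\<lambda>n.
     \<Sum>i\<le>m+n. \<Sum>j\<le>m+n. coeff2 F i j * coeff2 (A^i * B^j) m n))"

definition deriv_q :: "real fps fps \<Rightarrow> real fps fps" where
  "deriv_q F = fps_deriv F"

definition deriv_p :: "real fps fps \<Rightarrow> real fps fps" where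
  "deriv_p F = Abs_fps (\<lambda>i. fps_deriv (fps_nth F i))"

text \<open>
  The formal map \<open>(q, p) \<mapsto> (A(q,p), B(q,p))\<close> fixes the origin and satisfies
  \<open>dA \<and> dB = dq \<and> dp\<close>. Its linear part then has determinant 1, so the map is formally invertible.
\<close>

definition formal_symplectic :: "real fps fps \<Rightarrow> real fps fps \<Rightarrow> bool" where
  "formal_symplectic A B \<longleftrightarrow>
     coeff2 A 0 0 = 0 \<and> coeff2 B 0 0 = 0 \<and>
     deriv_q A * deriv_p B - deriv_p A * deriv_q B = 1"

text \<open>The series \<open>h(qp)\<close> in two variables, for a series \<open>h\<close> in one variable.\<close>

definition of_product :: "real fps \<Rightarrow> real fps fps" where
  "of_product h = Abs_fps (\<lambda>i. Abs_fps (\<lambda>j. if i = j then fps_nth h i else 0))"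

text \<open>
  Birkhoff normal form at the origin. Composing with the symplectic map \<open>(q, p) \<mapsto> (p, -q)\<close>
  turns \<open>h(J)\<close> into \<open>h(-J)\<close>; requiring the linear term of \<open>h\<close> to be \<open>+J\<close> removes this ambiguity.
\<close>

definition birkhoff_normal_form :: "(real \<Rightarrow> real \<Rightarrow> real) \<Rightarrow> real fps \<Rightarrow> bool" where
  "birkhoff_normal_form H h \<longleftrightarrow>
     (\<exists>A B. formal_symplectic A B \<and> compose2 (taylor2 H) A B = of_product h) \<and>
     fps_nth h 1 = 1"

end

theory Submission
  imports Defs
begin

text \<open>
  The idea is to compute in coordinates \<open>x, y\<close> in which the Hamiltonian is exactly \<open>xy\<close>; all the
  information then sits in the area form. For the Euler top such coordinates are explicit: with
  \<open>\<tau> = sqrt (2\<rho>)\<close>, let \<open>\<tau>/2 \<cdot> (x + y) = sin q\<close> and \<open>y - x = \<tau> \<cdot> r(x + y) \<cdot> p\<close>, where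
  \<open>r(z)\<^sup>2 = 1 + z\<^sup>2/(2\<rho>)\<close>. Then \<open>H = xy\<close>, and \<open>dq \<and> dp = G(x + y) dx \<and> dy\<close> with
  \<open>G(z) = 1 / sqrt (1 - \<kappa>z\<^sup>2/2 - z^4/4)\<close>.

  Uniqueness and the value of the normal form. A symplectic map that brings \<open>H\<close> to \<open>h(qp)\<close>
  gives, after this substitution, series \<open>X, Y\<close> in \<open>(q,p)\<close> with \<open>XY = h(qp)\<close> and
  \<open>G(X + Y) \<cdot> {X,Y} = 1\<close>. Call \<open>diag F\<close> the one-variable series of the coefficients of
  \<open>(qp)^n\<close> in \<open>F\<close>; up to a constant factor it is the integral of \<open>F dq \<and> dp / d(qp)\<close> over the
  vanishing cycle of \<open>qp = const\<close>. It satisfies the change of variables formula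
  \<open>diag (F(X,Y) \<cdot> {X,Y}) = (diag F \<circ> h) \<cdot> h'\<close> (lemma \<open>diag_change_of_variables\<close>), because a
  bracket with \<open>XY = h(qp)\<close> has no diagonal part, which kills the monomials \<open>X^i Y^j\<close> with
  \<open>i \<noteq> j\<close>. Applied to \<open>F = G(x + y)\<close> it says \<open>(K \<circ> h)' = 1\<close>, where
  \<open>K' = diag (G(x + y))\<close>: the normal form \<open>h\<close> is the compositional inverse of the action \<open>K\<close>
  as a function of the energy. As \<open>(x + y)^(2n)\<close> has middle coefficient \<open>2n choose n\<close>, the
  coefficients of \<open>K'\<close> are those of \<open>G\<close> times central binomial coefficients, and the stated
  expansion follows by inverting \<open>K\<close> up to order seven.

  Existence. For a series \<open>g(x,y)\<close> with constant term 1, let \<open>K' = diag g\<close>. Since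
  \<open>g / K'(xy) - 1\<close> has no diagonal part, it equals \<open>x v\<^sub>x - y v\<^sub>y\<close> for an explicit series \<open>v\<close>,
  and \<open>Q = x exp(v)\<close>, \<open>P = (K(xy)/x) exp(-v)\<close> satisfy \<open>QP = K(xy)\<close> and \<open>{Q,P} = g\<close> (lemma
  \<open>straighten_area_form\<close>). A formal inverse of \<open>(x,y) \<mapsto> (Q,P)\<close>, obtained by a contraction
  argument, expresses \<open>x, y\<close> through canonical variables in the required way, and undoing
  the explicit substitution gives the symplectic map.
\<close>

section \<open>Formal power series in two variables\<close>

abbreviation scalar :: "real \<Rightarrow> real fps fps" where
  "scalar c \<equiv> fps_const (fps_const c)"

abbreviation var_q :: "real fps fps" where "var_q \<equiv> fps_X"

abbreviation var_p :: "real fps fps" where "var_p \<equiv> fps_const fps_X"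

definition monom2 :: "real \<Rightarrow> nat \<Rightarrow> nat \<Rightarrow> real fps fps" where
  "monom2 c i j = scalar c * var_q ^ i * var_p ^ j"

text \<open>
  Vanishing of all terms of total degree less than \<open>n\<close>. Substitution is
  continuous for the filtration by total degree, but not for the filtration by powers of \<open>q\<close> alone,
  because \<open>A\<close> and \<open>B\<close> may contain terms free of \<open>q\<close>.
\<close>

definition order_ge :: "nat \<Rightarrow> real fps fps \<Rightarrow> bool" where
  "order_ge n F \<longleftrightarrow> (\<forall>i j. i + j < n \<longrightarrow> coeff2 F i j = 0)"

lemma fps2_eqI: "(\<And>i j. coeff2 F i j = coeff2 G i j) \<Longrightarrow> F = G"
  by (intro fps_ext) auto

lemma coeff2_mult:
  "coeff2 (F * G) m n = (\<Sum>i\<le>m. \<Sum>j\<le>n. coeff2 F i j * coeff2 G (m - i) (n - j))"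
  by (simp add: fps_mult_nth fps_sum_nth atLeast0AtMost)

lemma coeff2_sum: "coeff2 (\<Sum>x\<in>S. F x) m n = (\<Sum>x\<in>S. coeff2 (F x) m n)"
  by (simp add: fps_sum_nth)

lemma coeff2_monom2: "coeff2 (monom2 c i j) m n = (if m = i \<and> n = j then c else 0)"
proof -
  have "monom2 c i j = fps_X ^ i * fps_const (fps_const c * fps_X ^ j)"
    by (simp add: monom2_def fps_const_power flip: fps_const_mult)
  thus ?thesis by (simp add: fps_X_power_nth)
qed

lemma monom2_mult: "monom2 c i j * monom2 d k l = monom2 (c * d) (i + k) (j + l)"
  by (simp add: monom2_def power_add algebra_simps flip: fps_const_mult)

lemma order_ge_0 [simp]: "order_ge 0 F"
  and order_ge_zero [simp]: "order_ge n 0"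
  by (simp_all add: order_ge_def)

lemma order_ge_mono: "order_ge n F \<Longrightarrow> m \<le> n \<Longrightarrow> order_ge m F"
  by (auto simp: order_ge_def)

lemma order_ge_add: "order_ge n F \<Longrightarrow> order_ge n G \<Longrightarrow> order_ge n (F + G)"
  and order_ge_diff: "order_ge n F \<Longrightarrow> order_ge n G \<Longrightarrow> order_ge n (F - G)"
  and order_ge_minus: "order_ge n F \<Longrightarrow> order_ge n (- F)"
  by (auto simp: order_ge_def)

lemma order_ge_1_iff: "order_ge (Suc 0) F \<longleftrightarrow> coeff2 F 0 0 = 0"
  by (auto simp: order_ge_def)

lemma order_ge_mult:
  assumes "order_ge a F" "order_ge b G"
  shows "order_ge (a + b) (F * G)"
  unfolding order_ge_def
proof (intro allI impI)
  fix m n assume mn: "m + n < a + b"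
  have "coeff2 F i j * coeff2 G (m - i) (n - j) = 0" if "i \<le> m" "j \<le> n" for i j
  proof -
    from mn that have "i + j < a \<or> (m - i) + (n - j) < b" by linarith
    thus ?thesis using assms by (auto simp: order_ge_def)
  qed
  thus "coeff2 (F * G) m n = 0"
    by (auto simp: coeff2_mult intro!: sum.neutral)
qed

lemma order_ge_mult_left: "order_ge n F \<Longrightarrow> order_ge n (G * F)"
  and order_ge_mult_right: "order_ge n F \<Longrightarrow> order_ge n (F * G)"
  using order_ge_mult[of 0 G n F] order_ge_mult[of n F 0 G] by simp_all

lemma order_ge_power: "order_ge (Suc 0) A \<Longrightarrow> order_ge n (A ^ n)"
  by (induction n) (auto dest: order_ge_mult[of "Suc 0"])

lemma order_ge_all_eq_0: "(\<And>n. order_ge n F) \<Longrightarrow> F = 0"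
proof (rule fps2_eqI)
  fix i j assume "\<And>n. order_ge n F"
  from this[of "Suc (i + j)"] show "coeff2 F i j = coeff2 0 i j"
    by (auto simp: order_ge_def)
qed

text \<open>
  Additive operators that are continuous for the total-degree topology are determined by their
  values on monomials; this is how all identities for substitution are obtained below.
\<close>

definition continuous_additive :: "(real fps fps \<Rightarrow> real fps fps) \<Rightarrow> bool" where
  "continuous_additive T \<longleftrightarrow> (\<forall>F G. T (F + G) = T F + T G) \<and>
     (\<forall>n. \<exists>N. \<forall>F. order_ge N F \<longrightarrow> order_ge n (T F))"

lemma continuous_additiveI:
  assumes "\<And>F G. T (F + G) = T F + T G" "\<And>n F. order_ge (n + d) F \<Longrightarrow> order_ge n (T F)"
  shows "continuous_additive T"
  using assms unfolding continuous_additive_def by blast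

lemma continuous_additive_add:
  assumes "continuous_additive T" "continuous_additive U"
  shows "continuous_additive (\<lambda>F. T F + U F)"
  unfolding continuous_additive_def
proof (intro conjI allI)
  fix F G show "T (F + G) + U (F + G) = T F + U F + (T G + U G)"
    using assms by (simp add: continuous_additive_def)
next
  fix n
  obtain N where N: "\<And>F. order_ge N F \<Longrightarrow> order_ge n (T F)"
    using assms(1) unfolding continuous_additive_def by blast
  obtain M where M: "\<And>F. order_ge M F \<Longrightarrow> order_ge n (U F)"
    using assms(2) unfolding continuous_additive_def by blast
  show "\<exists>N. \<forall>F. order_ge N F \<longrightarrow> order_ge n (T F + U F)"
    by (rule exI[of _ "max M N"]) (auto intro!: order_ge_add M N elim: order_ge_mono)
qed

lemma continuous_additive_comp:
  assumes "continuous_additive T" "continuous_additive U"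
  shows "continuous_additive (\<lambda>F. T (U F))"
  using assms unfolding continuous_additive_def by metis

lemma continuous_additive_mult: "continuous_additive (\<lambda>F. G * F)"
  by (rule continuous_additiveI[where d = 0]) (auto simp: distrib_left intro: order_ge_mult_left)

lemma continuous_additive_mult_right: "continuous_additive (\<lambda>F. F * G)"
  by (rule continuous_additiveI[where d = 0]) (auto simp: distrib_right intro: order_ge_mult_right)

text \<open>
  A polynomial truncation of \<open>F\<close> carries all of \<open>F\<close> that matters up to a given degree of the
  result, so it is enough to compare monomials.
\<close>

lemma continuous_additive_eqI:
  assumes T: "continuous_additive T" and U: "continuous_additive U"
    and eq: "\<And>c i j. T (monom2 c i j) = U (monom2 c i j)"
  shows "T F = U F"
proof -
  define D where "D F = T F - U F" for F
  have "continuous_additive (\<lambda>F. T F + (- 1) * U F)"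
    by (intro continuous_additive_add T continuous_additive_comp[OF continuous_additive_mult U])
  hence D: "continuous_additive D" by (simp add: D_def [abs_def])
  have add: "D (F + G) = D F + D G" for F G using D by (simp add: continuous_additive_def)
  have D0: "D 0 = 0" using add[of 0 0] by simp
  have sum: "D (\<Sum>x\<in>S. f x) = (\<Sum>x\<in>S. D (f x))" for S :: "nat set" and f
    by (induction S rule: infinite_finite_induct) (auto simp: add D0)
  have "order_ge n (D F)" for n
  proof -
    obtain N where N: "\<And>F. order_ge N F \<Longrightarrow> order_ge n (D F)"
      using D unfolding continuous_additive_def by blast
    define P where "P = (\<Sum>i<N. \<Sum>j<N. monom2 (coeff2 F i j) i j)"
    have coeff_P: "coeff2 P m k = coeff2 F m k" if "m < N" "k < N" for m k
    proof -
      have "coeff2 P m k = (\<Sum>i<N. \<Sum>j<N. if k = j then if m = i then coeff2 F i j else 0 else 0)"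
        by (simp only: P_def coeff2_sum coeff2_monom2) (intro sum.cong refl, auto)
      thus ?thesis using that by simp
    qed
    have "order_ge N (F - P)"
      using coeff_P by (auto simp: order_ge_def)
    hence "order_ge n (D (F - P))" by (rule N)
    moreover have "D P = 0" by (simp add: P_def sum) (simp add: D_def eq)
    moreover have "D F = D (F - P) + D P" by (simp flip: add)
    ultimately show ?thesis by simp
  qed
  hence "D F = 0" by (rule order_ge_all_eq_0)
  thus ?thesis by (simp add: D_def)
qed

section \<open>Substitution into formal power series in two variables\<close>

lemma order_ge_compose2:
  assumes "order_ge (Suc 0) A" "order_ge (Suc 0) B" "order_ge n F"
  shows "order_ge n (compose2 F A B)"
  unfolding order_ge_def
proof (intro allI impI)
  fix k l assume kl: "k + l < n"
  have "coeff2 F i j * coeff2 (A ^ i * B ^ j) k l = 0" for i j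
  proof (cases "i + j < n")
    case True thus ?thesis using assms(3) by (auto simp: order_ge_def)
  next
    case False
    have "order_ge (i + j) (A ^ i * B ^ j)"
      by (intro order_ge_mult order_ge_power assms)
    thus ?thesis using False kl by (auto simp: order_ge_def)
  qed
  thus "coeff2 (compose2 F A B) k l = 0"
    by (auto simp: compose2_def intro!: sum.neutral)
qed

lemma compose2_add: "compose2 (F + G) A B = compose2 F A B + compose2 G A B"
  by (intro fps2_eqI) (simp add: compose2_def distrib_right sum.distrib)

lemma continuous_additive_compose2:
  "order_ge (Suc 0) A \<Longrightarrow> order_ge (Suc 0) B \<Longrightarrow> continuous_additive (\<lambda>F. compose2 F A B)"
  by (rule continuous_additiveI[where d = 0]) (auto simp: compose2_add intro: order_ge_compose2)

lemma compose2_monom2: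
  assumes "order_ge (Suc 0) A" "order_ge (Suc 0) B"
  shows "compose2 (monom2 c i j) A B = scalar c * A ^ i * B ^ j"
proof (rule fps2_eqI)
  fix m n
  have ord: "order_ge (i + j) (A ^ i * B ^ j)"
    by (intro order_ge_mult order_ge_power assms)
  have "coeff2 (compose2 (monom2 c i j) A B) m n =
    (\<Sum>k\<le>m+n. \<Sum>l\<le>m+n. if l = j then if k = i then c * coeff2 (A ^ k * B ^ l) m n else 0 else 0)"
    by (simp only: compose2_def fps_nth_Abs_fps coeff2_monom2) (intro sum.cong refl, auto)
  also have "\<dots> = (if i \<le> m + n \<and> j \<le> m + n then c * coeff2 (A ^ i * B ^ j) m n else 0)"
    by (cases "j \<le> m + n") simp_all
  also have "\<dots> = c * coeff2 (A ^ i * B ^ j) m n"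
    using ord by (auto simp: order_ge_def)
  also have "\<dots> = coeff2 (scalar c * A ^ i * B ^ j) m n"
    by (simp add: mult.assoc)
  finally show "coeff2 (compose2 (monom2 c i j) A B) m n = coeff2 (scalar c * A ^ i * B ^ j) m n" .
qed

context
  fixes A B :: "real fps fps"
  assumes AB: "order_ge (Suc 0) A" "order_ge (Suc 0) B"
begin

text \<open>
  Both sides are bilinear and continuous, so the claim reduces to a product of two monomials, in
  each factor in turn.
\<close>

lemma compose2_mult: "compose2 (F * G) A B = compose2 F A B * compose2 G A B"
proof -
  note cont = continuous_additive_compose2[OF AB]
  have mon: "compose2 (monom2 c i j * G) A B = compose2 (monom2 c i j) A B * compose2 G A B"
    for c i j G
  proof (rule continuous_additive_eqI[of "\<lambda>G. compose2 (monom2 c i j * G) A B"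
          "\<lambda>G. compose2 (monom2 c i j) A B * compose2 G A B"])
    fix d k l
    show "compose2 (monom2 c i j * monom2 d k l) A B =
        compose2 (monom2 c i j) A B * compose2 (monom2 d k l) A B"
      by (simp add: monom2_mult compose2_monom2 AB power_add mult_ac flip: fps_const_mult)
  qed (intro continuous_additive_comp[OF cont continuous_additive_mult]
         continuous_additive_comp[OF continuous_additive_mult cont])+
  show ?thesis
    by (rule continuous_additive_eqI[of "\<lambda>F. compose2 (F * G) A B"
          "\<lambda>F. compose2 F A B * compose2 G A B"])
       (auto simp: mon intro!: continuous_additive_comp[OF cont continuous_additive_mult_right]
                 continuous_additive_comp[OF continuous_additive_mult_right cont])
qed

lemma compose2_scalar: "compose2 (scalar c) A B = scalar c"
  using compose2_monom2[OF AB, of c 0 0] by (simp add: monom2_def)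

lemma compose2_1: "compose2 1 A B = 1"
  using compose2_scalar[of 1] by simp

lemma compose2_var_q: "compose2 var_q A B = A"
  using compose2_monom2[OF AB, of 1 1 0] by (simp add: monom2_def)

lemma compose2_var_p: "compose2 var_p A B = B"
  using compose2_monom2[OF AB, of 1 0 1] by (simp add: monom2_def)

lemma compose2_diff: "compose2 (F - G) A B = compose2 F A B - compose2 G A B"
  using compose2_add[of "F - G" G A B] by simp

lemma compose2_0: "compose2 0 A B = 0"
  using compose2_scalar[of 0] by simp

lemma compose2_minus: "compose2 (- F) A B = - compose2 F A B"
  using compose2_diff[of 0 F] by (simp add: compose2_0)

lemma compose2_power: "compose2 (F ^ n) A B = compose2 F A B ^ n"
  by (induction n) (simp_all add: compose2_1 compose2_mult)

lemma coeff2_compose2_00: "coeff2 (compose2 F A B) 0 0 = coeff2 F 0 0"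
  by (simp add: compose2_def)

text \<open>
  Both sides are continuous in \<open>F\<close>; on a monomial the claim is that substitution is a ring
  homomorphism.
\<close>

lemma compose2_assoc:
  assumes "order_ge (Suc 0) C" "order_ge (Suc 0) D"
  shows "compose2 (compose2 F C D) A B = compose2 F (compose2 C A B) (compose2 D A B)"
proof -
  have *: "order_ge (Suc 0) (compose2 C A B)" "order_ge (Suc 0) (compose2 D A B)"
    using assms by (simp_all add: order_ge_1_iff coeff2_compose2_00)
  show ?thesis
    by (rule continuous_additive_eqI[of "\<lambda>F. compose2 (compose2 F C D) A B"])
       (auto simp: compose2_monom2 assms AB * compose2_mult compose2_power compose2_scalar
         intro!: continuous_additive_comp[of "\<lambda>F. compose2 F A B"] continuous_additive_compose2)
qed

end

lemmas compose2_simps = compose2_add compose2_diff compose2_minus compose2_mult compose2_power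
  compose2_0 compose2_1 compose2_scalar compose2_var_q compose2_var_p

section \<open>Derivations\<close>

lemma deriv_q_coeff: "coeff2 (deriv_q F) i j = (real i + 1) * coeff2 F (Suc i) j"
proof -
  have "(of_nat (Suc i) :: real fps) = fps_const (real (Suc i))"
    by (simp only: fps_of_nat)
  thus ?thesis by (simp add: deriv_q_def del: of_nat_Suc)
qed

lemma deriv_p_coeff: "coeff2 (deriv_p F) i j = (real j + 1) * coeff2 F i (Suc j)"
  by (simp add: deriv_p_def add.commute)

lemma deriv_q_add: "deriv_q (F + G) = deriv_q F + deriv_q G"
  and deriv_q_diff: "deriv_q (F - G) = deriv_q F - deriv_q G"
  and deriv_q_mult: "deriv_q (F * G) = deriv_q F * G + F * deriv_q G"
  and deriv_q_scalar: "deriv_q (scalar c) = 0"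
  and deriv_q_var_q: "deriv_q var_q = 1"
  and deriv_q_var_p: "deriv_q var_p = 0"
  by (simp_all add: deriv_q_def)

lemma deriv_p_add: "deriv_p (F + G) = deriv_p F + deriv_p G"
  and deriv_p_diff: "deriv_p (F - G) = deriv_p F - deriv_p G"
  by (intro fps2_eqI; simp add: deriv_p_coeff algebra_simps)+

lemma deriv_p_mult: "deriv_p (F * G) = deriv_p F * G + F * deriv_p G"
proof (intro fps_ext)
  fix i j
  have "fps_nth (deriv_p (F * G)) i = fps_deriv (\<Sum>k=0..i. fps_nth F k * fps_nth G (i - k))"
    by (simp add: deriv_p_def fps_mult_nth)
  also have "\<dots> = (\<Sum>k=0..i. fps_deriv (fps_nth F k) * fps_nth G (i - k) +
      fps_nth F k * fps_deriv (fps_nth G (i - k)))"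
    by (simp add: fps_deriv_sum add.commute)
  also have "\<dots> = fps_nth (deriv_p F * G + F * deriv_p G) i"
    by (simp add: deriv_p_def fps_mult_nth sum.distrib)
  finally show "coeff2 (deriv_p (F * G)) i j = coeff2 (deriv_p F * G + F * deriv_p G) i j" by simp
qed

lemma deriv_p_scalar: "deriv_p (scalar c) = 0"
  and deriv_p_var_q: "deriv_p var_q = 0"
  and deriv_p_var_p: "deriv_p var_p = 1"
  by (intro fps2_eqI; simp add: deriv_p_coeff fps_X_def fps_const_def)+

lemma deriv_q_deriv_p: "deriv_q (deriv_p F) = deriv_p (deriv_q F)"
  by (intro fps2_eqI) (simp add: deriv_p_coeff deriv_q_coeff)

lemmas deriv_simps = deriv_q_add deriv_q_diff deriv_q_mult deriv_q_scalar deriv_q_var_q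
  deriv_q_var_p deriv_p_add deriv_p_diff deriv_p_mult deriv_p_scalar deriv_p_var_q deriv_p_var_p

lemma continuous_additive_deriv_q: "continuous_additive deriv_q"
  by (rule continuous_additiveI[where d = 1]) (auto simp: deriv_simps order_ge_def deriv_q_coeff)

lemma continuous_additive_deriv_p: "continuous_additive deriv_p"
  by (rule continuous_additiveI[where d = 1]) (auto simp: deriv_simps order_ge_def deriv_p_coeff)

text \<open>
  Stated for an abstract continuous derivation, because it is needed for the two partial
  derivatives and for the rotation field \<open>q \<partial>\<^sub>q - p \<partial>\<^sub>p\<close>. The series that satisfy it form a
  subring by the product rule, which contains the variables.
\<close>

lemma compose2_chain_rule:
  assumes AB: "order_ge (Suc 0) A" "order_ge (Suc 0) B"
    and cont: "continuous_additive D"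
    and mult: "\<And>F G. D (F * G) = D F * G + F * D G"
    and const: "\<And>c. D (scalar c) = 0"
  shows "D (compose2 F A B) = compose2 (deriv_q F) A B * D A + compose2 (deriv_p F) A B * D B"
proof -
  let ?R = "\<lambda>F. compose2 (deriv_q F) A B * D A + compose2 (deriv_p F) A B * D B"
  have D1: "D 1 = 0" using const[of 1] by simp
  have closed: "D (compose2 (F * G) A B) = ?R (F * G)"
    if "D (compose2 F A B) = ?R F" "D (compose2 G A B) = ?R G" for F G
  proof -
    have "compose2 (deriv_q (F * G)) A B =
        compose2 (deriv_q F) A B * compose2 G A B + compose2 F A B * compose2 (deriv_q G) A B"
      by (simp only: deriv_q_mult compose2_add compose2_mult[OF AB])
    moreover have "compose2 (deriv_p (F * G)) A B =
        compose2 (deriv_p F) A B * compose2 G A B + compose2 F A B * compose2 (deriv_p G) A B"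
      by (simp only: deriv_p_mult compose2_add compose2_mult[OF AB])
    ultimately show ?thesis
      by (simp add: that compose2_mult[OF AB] mult algebra_simps)
  qed
  have q: "D (compose2 (var_q ^ i) A B) = ?R (var_q ^ i)" for i
    using closed[of var_q "var_q ^ k" for k]
    by (induction i) (use deriv_q_scalar[of 1] deriv_p_scalar[of 1] in \<open>auto simp: D1 compose2_simps AB deriv_simps\<close>)
  have p: "D (compose2 (var_p ^ i) A B) = ?R (var_p ^ i)" for i
    using closed[of var_p "var_p ^ k" for k]
    by (induction i) (use deriv_q_scalar[of 1] deriv_p_scalar[of 1] in \<open>auto simp: D1 compose2_simps AB deriv_simps\<close>)
  show ?thesis
  proof (rule continuous_additive_eqI[of "\<lambda>F. D (compose2 F A B)" ?R])
    fix c i j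
    have c: "D (compose2 (scalar c) A B) = ?R (scalar c)"
      by (simp add: compose2_simps AB const deriv_simps)
    show "D (compose2 (monom2 c i j) A B) = ?R (monom2 c i j)"
      unfolding monom2_def by (intro closed c q p)
  qed (intro continuous_additive_comp[OF cont] continuous_additive_compose2 AB
         continuous_additive_add continuous_additive_comp[OF continuous_additive_mult_right]
         continuous_additive_comp[of "\<lambda>F. compose2 F A B"]
         continuous_additive_deriv_q continuous_additive_deriv_p)+
qed

lemmas deriv_q_compose2 = compose2_chain_rule[OF _ _ continuous_additive_deriv_q deriv_q_mult deriv_q_scalar]
lemmas deriv_p_compose2 = compose2_chain_rule[OF _ _ continuous_additive_deriv_p deriv_p_mult deriv_p_scalar]

section \<open>Substitution into power series in one variable\<close>

definition lift_q :: "real fps \<Rightarrow> real fps fps" where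
  "lift_q c = Abs_fps (\<lambda>i. fps_const (fps_nth c i))"

text \<open>
  The substitution \<open>c(A)\<close> of a two-variable series into a one-variable one. Taking it as a case of
  two-variable substitution makes it inherit the ring laws, the chain rule and associativity.
\<close>

definition fps_at :: "real fps \<Rightarrow> real fps fps \<Rightarrow> real fps fps" where
  "fps_at c A = compose2 (lift_q c) A 0"

lemma coeff2_lift_q: "coeff2 (lift_q c) i j = (if j = 0 then fps_nth c i else 0)"
  by (simp add: lift_q_def)

lemma lift_q_add: "lift_q (c + d) = lift_q c + lift_q d"
  and lift_q_diff: "lift_q (c - d) = lift_q c - lift_q d"
  and lift_q_const: "lift_q (fps_const r) = scalar r"
  and lift_q_X: "lift_q fps_X = var_q"
  and lift_q_1: "lift_q 1 = 1"
  by (intro fps2_eqI; simp add: coeff2_lift_q fps_X_def)+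

lemma lift_q_mult: "lift_q (c * d) = lift_q c * lift_q d"
proof (rule fps_ext)
  fix n
  have "fps_const (\<Sum>i\<in>S. f i) = (\<Sum>i\<in>S. fps_const (f i :: real))" for S :: "nat set" and f
    by (induction S rule: infinite_finite_induct) (auto simp flip: fps_const_add)
  thus "fps_nth (lift_q (c * d)) n = fps_nth (lift_q c * lift_q d) n"
    by (simp add: lift_q_def fps_mult_nth)
qed

lemma lift_q_power: "lift_q (c ^ n) = lift_q c ^ n"
  by (induction n) (simp_all add: lift_q_1 lift_q_mult)

lemma deriv_lift_q: "deriv_q (lift_q c) = lift_q (fps_deriv c)" "deriv_p (lift_q c) = 0"
  by (intro fps2_eqI; simp add: deriv_q_coeff deriv_p_coeff coeff2_lift_q add.commute)+

lemma fps_at_add: "fps_at (c + d) A = fps_at c A + fps_at d A"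
  by (simp add: fps_at_def lift_q_add compose2_add)

lemma coeff2_fps_at_00: "coeff2 (fps_at c A) 0 0 = fps_nth c 0"
  by (simp add: fps_at_def compose2_def coeff2_lift_q)

context
  fixes A :: "real fps fps"
  assumes A: "order_ge (Suc 0) A"
begin

lemma fps_at_diff: "fps_at (c - d) A = fps_at c A - fps_at d A"
  and fps_at_mult: "fps_at (c * d) A = fps_at c A * fps_at d A"
  and fps_at_power: "fps_at (c ^ n) A = fps_at c A ^ n"
  and fps_at_const: "fps_at (fps_const r) A = scalar r"
  and fps_at_1: "fps_at 1 A = 1"
  and fps_at_X: "fps_at fps_X A = A"
  by (simp_all add: A fps_at_def lift_q_diff lift_q_mult lift_q_power lift_q_const lift_q_1
      lift_q_X compose2_simps)

lemma fps_at_chain_rule: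
  assumes "continuous_additive D" "\<And>F G. D (F * G) = D F * G + F * D G" "\<And>c. D (scalar c) = 0"
  shows "D (fps_at c A) = fps_at (fps_deriv c) A * D A"
proof -
  have "D 0 = 0" using assms(3)[of 0] by simp
  thus ?thesis
    unfolding fps_at_def using compose2_chain_rule[OF A _ assms, of 0 "lift_q c"]
    by (simp add: deriv_lift_q)
qed

lemmas deriv_q_fps_at = fps_at_chain_rule[OF continuous_additive_deriv_q deriv_q_mult deriv_q_scalar]
lemmas deriv_p_fps_at = fps_at_chain_rule[OF continuous_additive_deriv_p deriv_p_mult deriv_p_scalar]

lemma compose2_fps_at:
  assumes "order_ge (Suc 0) B" "order_ge (Suc 0) C"
  shows "compose2 (fps_at c A) B C = fps_at c (compose2 A B C)"
  using compose2_assoc[OF assms A, of 0 "lift_q c"] assms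
  by (simp add: fps_at_def compose2_simps)

lemma fps_at_compose:
  assumes "fps_nth d 0 = 0"
  shows "fps_at (c oo d) A = fps_at c (fps_at d A)"
proof -
  have d: "order_ge (Suc 0) (lift_q d)"
    using assms by (simp add: order_ge_1_iff coeff2_lift_q)
  have "lift_q (c oo d) = compose2 (lift_q c) (lift_q d) 0"
  proof (rule fps2_eqI)
    fix m n
    have "coeff2 (compose2 (lift_q c) (lift_q d) 0) m n =
       (\<Sum>i\<le>m+n. \<Sum>j\<le>m+n. if j = 0 then fps_nth c i * coeff2 (lift_q (d ^ i)) m n else 0)"
      unfolding compose2_def fps_nth_Abs_fps
      by (intro sum.cong refl) (auto simp: coeff2_lift_q lift_q_power)
    also have "\<dots> = (if n = 0 then \<Sum>i\<le>m. fps_nth c i * fps_nth (d ^ i) m else 0)"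
      by (simp add: coeff2_lift_q)
    finally show "coeff2 (lift_q (c oo d)) m n = coeff2 (compose2 (lift_q c) (lift_q d) 0) m n"
      by (simp add: coeff2_lift_q fps_compose_nth atLeast0AtMost)
  qed
  thus ?thesis
    unfolding fps_at_def using compose2_assoc[OF A _ d, of 0 0 "lift_q c"]
    by (simp add: A compose2_0)
qed

end

lemmas fps_at_simps = fps_at_add fps_at_diff fps_at_mult fps_at_power fps_at_const fps_at_1 fps_at_X

lemma order_ge_fps_at: "fps_nth c 0 = 0 \<Longrightarrow> order_ge (Suc 0) (fps_at c A)"
  by (simp add: order_ge_1_iff coeff2_fps_at_00)

section \<open>The Poisson bracket, functions of \<open>qp\<close> and the diagonal\<close>

definition bracket :: "real fps fps \<Rightarrow> real fps fps \<Rightarrow> real fps fps" where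
  "bracket F G = deriv_q F * deriv_p G - deriv_p F * deriv_q G"

text \<open>
  The derivation \<open>q \<partial>\<^sub>q - p \<partial>\<^sub>p\<close>, the Hamiltonian field of \<open>qp\<close>. It multiplies the
  coefficient of \<open>q^i p^j\<close> by \<open>i - j\<close>, so its kernel consists of the functions of \<open>qp\<close> and its
  image of the series without diagonal.
\<close>

definition rotation_deriv :: "real fps fps \<Rightarrow> real fps fps" where
  "rotation_deriv F = var_q * deriv_q F - var_p * deriv_p F"

definition diag :: "real fps fps \<Rightarrow> real fps" where
  "diag F = Abs_fps (\<lambda>n. coeff2 F n n)"

lemma bracket_self: "bracket F F = 0"
  and bracket_add_left: "bracket (F + G) K = bracket F K + bracket G K"
  and bracket_diff_left: "bracket (F - G) K = bracket F K - bracket G K"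
  and bracket_mult_left: "bracket (F * G) K = bracket F K * G + F * bracket G K"
  and bracket_add_right: "bracket K (F + G) = bracket K F + bracket K G"
  and bracket_diff_right: "bracket K (F - G) = bracket K F - bracket K G"
  and bracket_mult_right: "bracket K (F * G) = bracket K F * G + F * bracket K G"
  and bracket_scalar: "bracket (scalar c) F = 0" "bracket F (scalar c) = 0"
  by (simp_all add: bracket_def deriv_simps algebra_simps)

lemma bracket_swap: "bracket F G = - bracket G F"
  by (simp add: bracket_def)

lemmas bracket_simps = bracket_self bracket_add_left bracket_diff_left bracket_mult_left
  bracket_add_right bracket_diff_right bracket_mult_right bracket_scalar

lemma bracket_fps_at:
  assumes "order_ge (Suc 0) A"
  shows "bracket (fps_at c A) G = fps_at (fps_deriv c) A * bracket A G"
    "bracket G (fps_at c A) = fps_at (fps_deriv c) A * bracket G A"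
  using assms by (simp_all add: bracket_def deriv_q_fps_at deriv_p_fps_at algebra_simps)

lemma bracket_compose2:
  assumes "order_ge (Suc 0) A" "order_ge (Suc 0) B"
  shows "bracket (compose2 F A B) (compose2 G A B) = compose2 (bracket F G) A B * bracket A B"
  using assms
  by (simp add: bracket_def deriv_q_compose2 deriv_p_compose2 compose2_simps algebra_simps)

lemma coeff2_var_p_mult: "coeff2 (var_p * F) i j = (if j = 0 then 0 else coeff2 F i (j - 1))"
  by simp

lemma coeff2_rotation_deriv: "coeff2 (rotation_deriv F) i j = (real i - real j) * coeff2 F i j"
  by (cases i; cases j)
    (simp_all add: rotation_deriv_def deriv_q_coeff deriv_p_coeff coeff2_var_p_mult algebra_simps
       del: fps_mult_left_const_nth)

lemma coeff2_of_product: "coeff2 (of_product h) i j = (if i = j then fps_nth h i else 0)"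
  by (simp add: of_product_def)

lemma of_product_add: "of_product (h + k) = of_product h + of_product k"
  and of_product_const: "of_product (fps_const c) = scalar c"
  and of_product_1: "of_product 1 = 1"
  by (intro fps2_eqI; simp add: coeff2_of_product)+

lemma of_product_X: "of_product fps_X = var_q * var_p"
  by (intro fps2_eqI) (simp add: coeff2_of_product fps_X_def)

lemma coeff2_of_product_mult:
  "coeff2 (of_product h * F) m n =
     (\<Sum>i\<le>min m n. fps_nth h i * coeff2 F (m - i) (n - i))"
proof -
  have "coeff2 (of_product h * F) m n =
    (\<Sum>i\<le>m. \<Sum>j\<le>n. if j = i then fps_nth h i * coeff2 F (m - i) (n - i) else 0)"
    unfolding coeff2_mult by (intro sum.cong refl) (auto simp: coeff2_of_product)
  also have "\<dots> = (\<Sum>i\<le>m. if i \<le> n then fps_nth h i * coeff2 F (m - i) (n - i) else 0)"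
    by simp
  also have "\<dots> = (\<Sum>i\<le>min m n. fps_nth h i * coeff2 F (m - i) (n - i))"
    by (rule sum.mono_neutral_cong_right) auto
  finally show ?thesis .
qed

lemma diag_of_product_mult: "diag (of_product h * F) = h * diag F"
proof (rule fps_ext)
  fix n
  have "fps_nth (diag (of_product h * F)) n = coeff2 (of_product h * F) n n"
    by (simp only: diag_def fps_nth_Abs_fps)
  also have "\<dots> = (\<Sum>i\<le>n. fps_nth h i * fps_nth (diag F) (n - i))"
    by (simp only: coeff2_of_product_mult diag_def fps_nth_Abs_fps min.idem)
  finally show "fps_nth (diag (of_product h * F)) n = fps_nth (h * diag F) n"
    by (simp add: fps_mult_nth atLeast0AtMost)
qed

lemma of_product_mult: "of_product (h * k) = of_product h * of_product k"
proof (rule fps2_eqI)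
  fix m n
  have "coeff2 (of_product h * of_product k) m n =
      (\<Sum>i\<le>min m n. if m = n then fps_nth h i * fps_nth k (m - i) else 0)"
    unfolding coeff2_of_product_mult by (intro sum.cong refl) (auto simp: coeff2_of_product)
  thus "coeff2 (of_product (h * k)) m n = coeff2 (of_product h * of_product k) m n"
    by (cases "m = n") (simp_all add: coeff2_of_product fps_mult_nth[of h k] atLeast0AtMost)
qed

lemma of_product_power: "of_product (h ^ n) = of_product h ^ n"
  by (induction n) (simp_all add: of_product_1 of_product_mult)

lemma diag_of_product: "diag (of_product h) = h"
  by (intro fps_ext) (simp add: diag_def coeff2_of_product)

lemma of_product_inject: "of_product h = of_product k \<longleftrightarrow> h = k"
  using diag_of_product by metis

lemma deriv_of_product:
  "deriv_q (of_product h) = of_product (fps_deriv h) * var_p"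
  "deriv_p (of_product h) = of_product (fps_deriv h) * var_q"
proof -
  show "deriv_q (of_product h) = of_product (fps_deriv h) * var_p"
  proof (rule fps2_eqI)
    fix i j show "coeff2 (deriv_q (of_product h)) i j = coeff2 (of_product (fps_deriv h) * var_p) i j"
      by (cases j) (auto simp: deriv_q_coeff coeff2_of_product)
  qed
  show "deriv_p (of_product h) = of_product (fps_deriv h) * var_q"
  proof (rule fps2_eqI)
    fix i j show "coeff2 (deriv_p (of_product h)) i j = coeff2 (of_product (fps_deriv h) * var_q) i j"
      by (cases i) (auto simp: deriv_p_coeff coeff2_of_product)
  qed
qed

lemma bracket_of_product: "bracket F (of_product h) = of_product (fps_deriv h) * rotation_deriv F"
  by (simp add: bracket_def rotation_deriv_def deriv_of_product algebra_simps)

lemma diag_bracket_of_product: "diag (bracket F (of_product h)) = 0"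
  by (intro fps_ext) (simp add: bracket_of_product diag_of_product_mult diag_def[of "rotation_deriv F"]
      coeff2_rotation_deriv fps_mult_nth)

text \<open>
  Formal counterpart of the rule that the derivative of the integral of a one-form
  \<open>a dq + b dp\<close> over the cycle \<open>qp = J\<close> with respect to \<open>J\<close> is the integral of its exterior
  derivative divided by \<open>d(qp)\<close>.
\<close>

lemma diag_divergence:
  "diag (deriv_q b - deriv_p a) = fps_deriv (diag (var_p * b - var_q * a))"
  by (intro fps_ext) (simp add: diag_def deriv_q_coeff deriv_p_coeff algebra_simps)

lemma diag_add: "diag (F + G) = diag F + diag G"
  by (intro fps_ext) (simp add: diag_def)

text \<open>
  Embedding one-variable series as functions of \<open>qp\<close> makes the comparison on monomials available
  for operators whose values are one-variable series, such as the diagonal.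
\<close>

lemma continuous_additive_of_product:
  assumes "\<And>F G. T (F + G) = T F + T G"
    and "\<And>n F. order_ge (n + d) F \<Longrightarrow> (\<And>i. i + i < n \<Longrightarrow> fps_nth (T F) i = 0)"
  shows "continuous_additive (\<lambda>F. of_product (T F))"
  using assms by (intro continuous_additiveI[where d = d])
    (auto simp: of_product_add order_ge_def coeff2_of_product)

lemma of_product_eq_fps_at: "of_product h = fps_at h (var_q * var_p)"
proof (rule fps2_eqI)
  fix m n
  have qp: "(var_q * var_p) ^ i = of_product (fps_X ^ i)" for i
    by (simp add: of_product_power of_product_X)
  have "coeff2 (fps_at h (var_q * var_p)) m n =
    (\<Sum>i\<le>m+n. \<Sum>j\<le>m+n. if j = 0 then if i = m \<and> m = n then fps_nth h i else 0 else 0)"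
    unfolding fps_at_def compose2_def fps_nth_Abs_fps
    by (intro sum.cong refl) (auto simp: coeff2_lift_q qp coeff2_of_product fps_X_power_nth)
  also have "\<dots> = (if m = n then fps_nth h m else 0)"
    by (cases "m = n") auto
  finally show "coeff2 (of_product h) m n = coeff2 (fps_at h (var_q * var_p)) m n"
    by (simp add: coeff2_of_product)
qed

lemma order_ge_qp: "order_ge (Suc 0) (var_q * var_p)"
  and order_ge_var_q: "order_ge (Suc 0) var_q"
  and order_ge_var_p: "order_ge (Suc 0) var_p"
  by (simp_all add: order_ge_1_iff)

lemma compose2_of_product:
  assumes "order_ge (Suc 0) A" "order_ge (Suc 0) B"
  shows "compose2 (of_product h) A B = fps_at h (A * B)"
  by (simp add: of_product_eq_fps_at compose2_fps_at assms order_ge_qp compose2_simps)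

section \<open>Coordinates whose product is a function of \<open>qp\<close>\<close>

text \<open>
  The hypothesis says that \<open>(d/h)' = 0\<close>. The proof compares leading coefficients: if
  \<open>e = d - d\<^sub>1 h\<close> had order \<open>n\<close>, necessarily at least 2, then \<open>h' e\<close> and \<open>h e'\<close> would have leading
  coefficients \<open>e\<^sub>n\<close> and \<open>n e\<^sub>n\<close>.
\<close>

lemma proportional_if_wronskian_eq_0:
  fixes d h :: "real fps"
  assumes "fps_deriv h * d = h * fps_deriv d"
    and "fps_nth h 0 = 0" "fps_nth h 1 = 1" "fps_nth d 0 = 0"
  shows "d = fps_const (fps_nth d 1) * h"
proof (rule ccontr)
  define e where "e = d - fps_const (fps_nth d 1) * h"
  assume "d \<noteq> fps_const (fps_nth d 1) * h"
  hence "e \<noteq> 0" by (simp add: e_def)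
  define n where "n = subdegree e"
  have en: "fps_nth e n \<noteq> 0" using \<open>e \<noteq> 0\<close> by (simp add: n_def)
  have e_low: "fps_nth e i = 0" if "i < n" for i using that by (auto simp: n_def)
  have "fps_nth e 0 = 0" "fps_nth e 1 = 0" using assms by (simp_all add: e_def)
  with en have n: "n \<ge> 2" by (cases n; cases "n - 1") auto
  have eq: "fps_deriv h * e = h * fps_deriv e"
    using assms(1) by (simp add: e_def algebra_simps)
  have "fps_nth (fps_deriv h * e) n = (\<Sum>i=0..n. if i = 0 then fps_nth e n else 0)"
    unfolding fps_mult_nth using assms e_low by (intro sum.cong) auto
  hence l: "fps_nth (fps_deriv h * e) n = fps_nth e n" by simp
  have "fps_nth (h * fps_deriv e) n = (\<Sum>i=0..n. if i = 1 then real n * fps_nth e n else 0)"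
    unfolding fps_mult_nth
  proof (intro sum.cong refl)
    fix i assume i: "i \<in> {0..n}"
    show "fps_nth h i * fps_nth (fps_deriv e) (n - i) = (if i = 1 then real n * fps_nth e n else 0)"
    proof (cases "i \<le> 1")
      case True
      thus ?thesis using assms n by (cases i) auto
    next
      case False
      hence "Suc (n - i) < n" using i by auto
      thus ?thesis using False e_low[of "Suc (n - i)"] by simp
    qed
  qed
  hence "fps_nth (h * fps_deriv e) n = real n * fps_nth e n" using n by simp
  with l eq have "real n * fps_nth e n = fps_nth e n" by simp
  with en n show False by simp
qed

context
  fixes X Y :: "real fps fps" and h :: "real fps"
  assumes X: "order_ge (Suc 0) X" and Y: "order_ge (Suc 0) Y"
    and XY: "X * Y = of_product h" and h1: "fps_nth h 1 = 1"
    and bracket_00: "coeff2 (bracket X Y) 0 0 = 1"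
begin

lemma product_series_nth_0: "fps_nth h 0 = 0"
proof -
  have "coeff2 (X * Y) 0 0 = 0"
    using X Y by (simp add: coeff2_mult order_ge_1_iff)
  thus ?thesis by (simp add: XY coeff2_of_product)
qed

text \<open>
  The one-form \<open>\<eta> = X dY\<close> has exterior derivative \<open>dX \<and> dY\<close> and satisfies
  \<open>d(XY) \<and> \<eta> = XY dX \<and> dY\<close>. The series \<open>d\<close> of the proof is its integral over the
  cycles. The first identity gives \<open>d' = diag {X,Y}\<close>, the second
  \<open>h' d = h \<cdot> diag {X,Y}\<close>; hence \<open>d\<close> is proportional to \<open>h\<close>, and the linear terms agree.
\<close>

lemma diag_bracket: "diag (bracket X Y) = fps_deriv h"
proof -
  define d where "d = diag (var_p * (X * deriv_p Y) - var_q * (X * deriv_q Y))"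
  have "bracket X Y = deriv_q (X * deriv_p Y) - deriv_p (X * deriv_q Y)"
    by (simp add: bracket_def deriv_simps deriv_q_deriv_p algebra_simps)
  hence d': "diag (bracket X Y) = fps_deriv d"
    by (simp add: diag_divergence d_def)
  have "of_product (fps_deriv h) * (var_p * (X * deriv_p Y) - var_q * (X * deriv_q Y)) =
      X * (deriv_q (X * Y) * deriv_p Y - deriv_p (X * Y) * deriv_q Y)"
    unfolding XY deriv_of_product by (simp add: algebra_simps)
  also have "\<dots> = (X * Y) * bracket X Y"
    by (simp add: deriv_simps bracket_def algebra_simps)
  finally have "fps_deriv h * d = h * fps_deriv d"
    unfolding d_def XY
    by (metis d_def d' diag_of_product_mult)
  moreover have "fps_nth d 0 = 0" by (simp add: d_def diag_def)
  ultimately have d: "d = fps_const (fps_nth d 1) * h"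
    using proportional_if_wronskian_eq_0 product_series_nth_0 h1 by blast
  have "fps_nth d 1 = fps_nth (diag (bracket X Y)) 0" by (simp add: d')
  also have "\<dots> = 1" using bracket_00 by (simp add: diag_def)
  finally show ?thesis using d d' by simp
qed

text \<open>
  For \<open>i \<noteq> j\<close> the product is, up to the factor \<open>i - j\<close>, the bracket of \<open>X^i Y^j\<close> with
  \<open>XY = h(qp)\<close>, which has no diagonal; for \<open>i = j\<close> the factor \<open>(XY)^i = h(qp)^i\<close> can be taken
  out of the diagonal.
\<close>

lemma diag_monom_mult_bracket:
  "diag (X ^ i * Y ^ j * bracket X Y) = (if i = j then h ^ i * fps_deriv h else 0)"
proof (cases "i = j")
  case True
  have "X ^ j * Y ^ j = of_product (h ^ j)"
    by (simp add: of_product_power flip: XY power_mult_distrib)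
  hence "diag (X ^ j * Y ^ j * bracket X Y) = h ^ j * fps_deriv h"
    by (simp only: diag_of_product_mult diag_bracket)
  thus ?thesis using True by simp
next
  case False
  have "rotation_deriv (monom2 1 i j) = scalar (real i - real j) * monom2 1 i j"
    by (intro fps2_eqI) (simp add: coeff2_rotation_deriv coeff2_monom2)
  hence "bracket (monom2 1 i j) (of_product fps_X) = scalar (real i - real j) * monom2 1 i j"
    by (simp add: bracket_of_product of_product_1)
  moreover have "compose2 (of_product fps_X) X Y = of_product h"
    by (simp add: of_product_X compose2_simps X Y XY)
  ultimately have "bracket (X ^ i * Y ^ j) (of_product h) =
      scalar (real i - real j) * (X ^ i * Y ^ j * bracket X Y)"
    using bracket_compose2[OF X Y, of "monom2 1 i j" "of_product fps_X"]
    by (simp add: compose2_mult[OF X Y] compose2_scalar[OF X Y] compose2_monom2 X Y mult_ac)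
  hence "0 = diag (of_product (fps_const (real i - real j)) * (X ^ i * Y ^ j * bracket X Y))"
    by (simp add: of_product_const flip: diag_bracket_of_product[of "X ^ i * Y ^ j" h])
  thus ?thesis using False by (simp add: diag_of_product_mult del: fps_mult_left_const_nth)
qed

text \<open>
  The integral of \<open>F dx \<and> dy / d(xy)\<close> over the cycle \<open>xy = E\<close> does not depend on the coordinates;
  \<open>h'\<close> is the factor between \<open>d(XY)\<close> and \<open>d(qp)\<close>.
\<close>

lemma diag_change_of_variables:
  "diag (compose2 F X Y * bracket X Y) = (diag F oo h) * fps_deriv h"
proof -
  let ?L = "\<lambda>F. of_product (diag (compose2 F X Y * bracket X Y))"
  let ?R = "\<lambda>F. of_product ((diag F oo h) * fps_deriv h)"
  have "?L F = ?R F"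
  proof (rule continuous_additive_eqI[of ?L ?R])
    show "continuous_additive ?L"
    proof (rule continuous_additive_of_product[where d = 0])
      fix n F i assume "order_ge (n + 0) F" "i + i < n"
      moreover from this have "order_ge n (compose2 F X Y * bracket X Y)"
        by (intro order_ge_mult_right order_ge_compose2 X Y) simp
      ultimately show "fps_nth (diag (compose2 F X Y * bracket X Y)) i = 0"
        by (simp add: diag_def order_ge_def)
    qed (simp add: compose2_add distrib_right diag_add)
    show "continuous_additive ?R"
    proof (rule continuous_additive_of_product[where d = 0])
      fix n F i assume "order_ge (n + 0) F" "i + i < n"
      thus "fps_nth ((diag F oo h) * fps_deriv h) i = 0"
        by (auto simp: fps_mult_nth fps_compose_nth diag_def order_ge_def intro!: sum.neutral)
    qed (simp add: fps_compose_add_distrib distrib_right diag_add)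
    fix c i j
    have "diag (monom2 c i j) = (if i = j then fps_const c * fps_X ^ i else 0)"
      by (intro fps_ext) (auto simp: diag_def coeff2_monom2 fps_X_power_nth)
    hence "(diag (monom2 c i j) oo h) * fps_deriv h =
        fps_const c * (if i = j then h ^ i * fps_deriv h else 0)"
      by (simp add: product_series_nth_0 fps_compose_mult_distrib mult.assoc fps_X_power_compose)
    also have "\<dots> = diag (of_product (fps_const c) * (X ^ i * Y ^ j * bracket X Y))"
      by (simp only: diag_of_product_mult diag_monom_mult_bracket)
    also have "\<dots> = diag (compose2 (monom2 c i j) X Y * bracket X Y)"
      by (simp add: of_product_const compose2_monom2 X Y mult.assoc)
    finally show "?L (monom2 c i j) = ?R (monom2 c i j)" by simp
  qed
  thus ?thesis by (simp add: of_product_inject)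
qed

text \<open>
  The change of variables formula turns the hypothesis on \<open>g\<close> into \<open>(K \<circ> h)' = 1\<close>. So \<open>h\<close> does
  not depend on \<open>X\<close> and \<open>Y\<close>, which is the uniqueness of the normal form.
\<close>

lemma normalised_eq_fps_inv:
  assumes g: "compose2 g X Y * bracket X Y = 1"
    and K: "fps_deriv K = diag g" "fps_nth K 0 = 0"
  shows "h = fps_inv K"
proof -
  have "fps_deriv (K oo h) = 1"
    using diag_change_of_variables[of g] g diag_of_product[of 1]
    by (simp add: fps_compose_deriv product_series_nth_0 K of_product_1)
  hence "fps_deriv (K oo h) = fps_deriv fps_X" by simp
  hence Kh: "K oo h = fps_X"
    unfolding fps_deriv_eq_iff using K by simp
  have "coeff2 g 0 0 = 1"
    using arg_cong[OF g, of "\<lambda>F. coeff2 F 0 0"] bracket_00 by (simp add: coeff2_compose2_00 X Y)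
  hence K1: "fps_nth K 1 = 1"
    using arg_cong[OF K(1), of "\<lambda>F. fps_nth F 0"] by (simp add: diag_def)
  have "h = (fps_inv K oo K) oo h"
    using fps_inv[of K] K K1 product_series_nth_0 by simp
  also have "\<dots> = fps_inv K oo (K oo h)"
    using K product_series_nth_0 by (simp add: fps_compose_assoc)
  finally show ?thesis by (simp add: Kh)
qed

end

section \<open>Formal inversion\<close>

lemma order_ge_power_diff:
  assumes "order_ge (Suc 0) X" "order_ge (Suc 0) X'" "order_ge (Suc n) (X - X')"
  shows "order_ge (n + i) (X ^ i - X' ^ i)"
proof (induction i)
  case (Suc i)
  have "X ^ Suc i - X' ^ Suc i = X * (X ^ i - X' ^ i) + (X - X') * X' ^ i"
    by (simp add: algebra_simps)
  moreover have "order_ge (Suc 0 + (n + i)) (X * (X ^ i - X' ^ i))"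
    by (intro order_ge_mult assms Suc)
  moreover have "order_ge (Suc n + i) ((X - X') * X' ^ i)"
    by (intro order_ge_mult assms order_ge_power)
  ultimately show ?case by (simp add: order_ge_add)
qed simp

text \<open>
  Two approximations that agree below degree \<open>n + 1\<close> have monomials that agree in \<open>i + j - 1\<close>
  further degrees, since each term of the difference keeps \<open>i + j - 1\<close> factors of positive order.
\<close>

lemma order_ge_monom_diff:
  assumes "order_ge (Suc 0) X" "order_ge (Suc 0) X'" "order_ge (Suc n) (X - X')"
    and "order_ge (Suc 0) Y" "order_ge (Suc 0) Y'" "order_ge (Suc n) (Y - Y')"
  shows "order_ge (n + i + j) (X ^ i * Y ^ j - X' ^ i * Y' ^ j)"
proof -
  have "X ^ i * Y ^ j - X' ^ i * Y' ^ j = (X ^ i - X' ^ i) * Y ^ j + X' ^ i * (Y ^ j - Y' ^ j)"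
    by (simp add: algebra_simps)
  moreover have "order_ge (n + i + j) ((X ^ i - X' ^ i) * Y ^ j)"
    by (intro order_ge_mult order_ge_power_diff order_ge_power assms)
  moreover have "order_ge (i + (n + j)) (X' ^ i * (Y ^ j - Y' ^ j))"
    by (intro order_ge_mult order_ge_power_diff order_ge_power assms)
  ultimately show ?thesis by (simp add: order_ge_add add_ac)
qed

lemma order_ge_compose2_diff:
  assumes "order_ge (Suc 0) X" "order_ge (Suc 0) X'" "order_ge (Suc n) (X - X')"
    and "order_ge (Suc 0) Y" "order_ge (Suc 0) Y'" "order_ge (Suc n) (Y - Y')"
    and R: "order_ge 2 R"
  shows "order_ge (Suc (Suc n)) (compose2 R X Y - compose2 R X' Y')"
  unfolding order_ge_def
proof (intro allI impI)
  fix k l assume kl: "k + l < Suc (Suc n)"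
  have "coeff2 R i j * coeff2 (X ^ i * Y ^ j - X' ^ i * Y' ^ j) k l = 0" for i j
  proof (cases "i + j < 2")
    case True thus ?thesis using R by (simp add: order_ge_def)
  next
    case False
    have "order_ge (n + i + j) (X ^ i * Y ^ j - X' ^ i * Y' ^ j)"
      by (rule order_ge_monom_diff) (use assms in auto)
    thus ?thesis using False kl by (simp add: order_ge_def)
  qed
  moreover have "coeff2 (compose2 R X Y - compose2 R X' Y') k l =
    (\<Sum>i\<le>k+l. \<Sum>j\<le>k+l. coeff2 R i j * coeff2 (X ^ i * Y ^ j - X' ^ i * Y' ^ j) k l)"
    by (simp only: fps_sub_nth compose2_def fps_nth_Abs_fps right_diff_distrib sum_subtractf)
  ultimately show "coeff2 (compose2 R X Y - compose2 R X' Y') k l = 0"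
    by (simp only: sum.neutral_const)
qed

text \<open>
  The pair \<open>(X, Y)\<close> is the fixed point of \<open>(X, Y) \<mapsto> (q - R(X,Y), p - S(X,Y))\<close>, where \<open>R\<close> and \<open>S\<close>
  are the parts of \<open>Q\<close> and \<open>P\<close> of order at least 2. Each iteration fixes one more degree.
\<close>

lemma formal_right_inverse:
  assumes "order_ge 2 (Q - var_q)" "order_ge 2 (P - var_p)"
  shows "\<exists>X Y. order_ge (Suc 0) X \<and> order_ge (Suc 0) Y \<and>
    compose2 Q X Y = var_q \<and> compose2 P X Y = var_p"
proof -
  define R S where "R = Q - var_q" and "S = P - var_p"
  have R: "order_ge 2 R" and S: "order_ge 2 S" using assms by (simp_all add: R_def S_def)
  define step where "step = (\<lambda>(X, Y). (var_q - compose2 R X Y, var_p - compose2 S X Y))"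
  define U where "U n = fst ((step ^^ n) (0, 0))" for n
  define V where "V n = snd ((step ^^ n) (0, 0))" for n
  have rec: "U (Suc n) = var_q - compose2 R (U n) (V n)"
    "V (Suc n) = var_p - compose2 S (U n) (V n)" for n
    by (simp_all add: U_def V_def step_def case_prod_unfold)
  have UV0: "U 0 = 0" "V 0 = 0" by (simp_all add: U_def V_def)
  have RS1: "order_ge (Suc 0) R" "order_ge (Suc 0) S"
    using R S by (auto elim: order_ge_mono)
  have UV: "order_ge (Suc 0) (U n) \<and> order_ge (Suc 0) (V n)" for n
    by (induction n) (auto simp: UV0 rec
      intro!: order_ge_diff order_ge_compose2 RS1 order_ge_var_q order_ge_var_p)
  have step_diff: "order_ge (Suc n) (U (Suc n) - U n) \<and> order_ge (Suc n) (V (Suc n) - V n)" for n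
  proof (induction n)
    case 0
    show ?case using UV[of 1] by (simp add: UV0)
  next
    case (Suc n)
    have "order_ge (Suc (Suc n)) (compose2 T (U (Suc n)) (V (Suc n)) - compose2 T (U n) (V n))"
      if "order_ge 2 T" for T
      using order_ge_compose2_diff[of "U (Suc n)" "U n" n "V (Suc n)" "V n" T] UV Suc that by blast
    from order_ge_minus[OF this[OF R]] order_ge_minus[OF this[OF S]] show ?case
      by (simp add: rec[of "Suc n"] rec[of n])
  qed
  have cauchy: "order_ge (Suc n) (U (n + k) - U n) \<and> order_ge (Suc n) (V (n + k) - V n)" for n k
  proof (induction k)
    case (Suc k)
    have "order_ge (Suc n) (U (Suc (n + k)) - U (n + k))"
      "order_ge (Suc n) (V (Suc (n + k)) - V (n + k))"
      using step_diff[of "n + k"] by (auto elim: order_ge_mono)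
    thus ?case using Suc order_ge_add[of "Suc n" _ "U (n + k) - U n"]
        order_ge_add[of "Suc n" _ "V (n + k) - V n"] by force
  qed auto
  \<comment> \<open>The terms of degree \<open>n\<close> are stationary from the \<open>n\<close>-th iterate on.\<close>
  define X where "X = Abs_fps (\<lambda>i. Abs_fps (\<lambda>j. coeff2 (U (i + j)) i j))"
  define Y where "Y = Abs_fps (\<lambda>i. Abs_fps (\<lambda>j. coeff2 (V (i + j)) i j))"
  have lim: "order_ge (Suc n) (U n - X) \<and> order_ge (Suc n) (V n - Y)" for n
  proof -
    have "coeff2 (U n) i j = coeff2 X i j \<and> coeff2 (V n) i j = coeff2 Y i j" if "i + j < Suc n" for i j
      using cauchy[of "i + j" "n - (i + j)"] that by (simp add: X_def Y_def order_ge_def)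
    thus ?thesis by (simp add: order_ge_def)
  qed
  have X: "order_ge (Suc 0) X" and Y: "order_ge (Suc 0) Y"
    using UV[of 0] by (auto simp: order_ge_1_iff X_def Y_def)
  have conv: "order_ge (Suc n) (compose2 T (U n) (V n) - compose2 T X Y)" if "order_ge 2 T" for T n
    using order_ge_compose2_diff[of "U n" X n "V n" Y T] UV X Y lim that by (auto elim: order_ge_mono)
  have "order_ge n (X - (var_q - compose2 R X Y))" for n
  proof -
    have "X - (var_q - compose2 R X Y) =
        - (U (Suc n) - X) - (compose2 R (U n) (V n) - compose2 R X Y)"
      by (simp add: rec)
    moreover have "order_ge (Suc n) (U (Suc n) - X)" using lim[of "Suc n"] by (auto elim: order_ge_mono)
    ultimately have "order_ge (Suc n) (X - (var_q - compose2 R X Y))"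
      using conv[OF R, of n] by (simp only: order_ge_diff order_ge_minus)
    thus ?thesis by (rule order_ge_mono) simp
  qed
  from order_ge_all_eq_0[OF this] have "X + compose2 R X Y = var_q" by (simp add: algebra_simps)
  moreover have "order_ge n (Y - (var_p - compose2 S X Y))" for n
  proof -
    have "Y - (var_p - compose2 S X Y) =
        - (V (Suc n) - Y) - (compose2 S (U n) (V n) - compose2 S X Y)"
      by (simp add: rec)
    moreover have "order_ge (Suc n) (V (Suc n) - Y)" using lim[of "Suc n"] by (auto elim: order_ge_mono)
    ultimately have "order_ge (Suc n) (Y - (var_p - compose2 S X Y))"
      using conv[OF S, of n] by (simp only: order_ge_diff order_ge_minus)
    thus ?thesis by (rule order_ge_mono) simp
  qed
  from order_ge_all_eq_0[OF this] have "Y + compose2 S X Y = var_p" by (simp add: algebra_simps)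
  moreover have "Q = var_q + R" "P = var_p + S" by (simp_all add: R_def S_def)
  ultimately have "compose2 Q X Y = var_q" "compose2 P X Y = var_p"
    by (simp_all add: compose2_add compose2_var_q compose2_var_p X Y)
  with X Y show ?thesis by blast
qed

section \<open>Straightening an area form along the level sets of \<open>xy\<close>\<close>

lemma continuous_additive_rotation_deriv: "continuous_additive rotation_deriv"
  by (rule continuous_additiveI[where d = 0])
     (auto simp: order_ge_def coeff2_rotation_deriv intro!: fps2_eqI simp: algebra_simps)

lemma rotation_deriv_mult:
  "rotation_deriv (F * G) = rotation_deriv F * G + F * rotation_deriv G"
  by (simp add: rotation_deriv_def deriv_simps algebra_simps)

lemma rotation_deriv_scalar: "rotation_deriv (scalar c) = 0"
  by (simp add: rotation_deriv_def deriv_simps)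

lemmas rotation_deriv_fps_at =
  fps_at_chain_rule[OF _ continuous_additive_rotation_deriv rotation_deriv_mult rotation_deriv_scalar]

text \<open>
  Here \<open>q, p\<close> play the role of the coordinates \<open>x, y\<close> with \<open>H = xy\<close>. With \<open>Q = q W\<close> and
  \<open>QP = K(qp)\<close>, the bracket is determined by
  \<open>Q {Q,P} = {Q, K(qp)} = K'(qp) (q \<partial>\<^sub>q - p \<partial>\<^sub>p) Q\<close>. For \<open>W = exp v\<close> the right-hand side is
  \<open>K'(qp) Q (1 + (q \<partial>\<^sub>q - p \<partial>\<^sub>p) v)\<close>, so \<open>v\<close> has to solve
  \<open>(q \<partial>\<^sub>q - p \<partial>\<^sub>p) v = g / K'(qp) - 1\<close>. This is possible exactly because \<open>K'\<close> is the diagonal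
  of \<open>g\<close>.
\<close>

lemma straighten_area_form:
  assumes g: "coeff2 g 0 0 = 1"
  shows "\<exists>Q P K. order_ge 2 (Q - var_q) \<and> order_ge 2 (P - var_p) \<and>
    bracket Q P = g \<and> Q * P = of_product K \<and> fps_deriv K = diag g \<and> fps_nth K 0 = 0"
proof -
  define k where "k = diag g"
  have k0: "fps_nth k 0 = 1" using g by (simp add: k_def diag_def)
  define K where "K = fps_integral0 k"
  have K: "fps_deriv K = k" "fps_nth K 0 = 0" by (simp_all add: K_def fps_deriv_fps_integral)
  have K1: "fps_nth K 1 = 1" using arg_cong[OF K(1), of "\<lambda>F. fps_nth F 0"] k0 by simp
  define m where "m = fps_shift 1 K"
  have m: "K = fps_X * m" "fps_nth m 0 = 1"
    using K K1 by (auto simp: m_def fps_eq_iff fps_X_mult_nth)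
  define r where "r = of_product (inverse k) * g - 1"
  have r: "of_product k * (1 + r) = g"
    using k0 by (simp add: r_def inverse_mult_eq_1' of_product_1 flip: mult.assoc of_product_mult)
  have "diag r = 0"
  proof -
    have "diag r + 1 = inverse k * k"
      using diag_add[of r 1] diag_of_product[of 1]
      by (simp add: r_def of_product_1 diag_of_product_mult k_def)
    thus ?thesis using k0 by (simp add: inverse_mult_eq_1)
  qed
  hence r_diag: "coeff2 r i i = 0" for i
    by (simp add: fps_eq_iff diag_def)
  \<comment> \<open>On the diagonal the quotient is \<open>0 / 0 = 0\<close>.\<close>
  define v where "v = Abs_fps (\<lambda>i. Abs_fps (\<lambda>j. coeff2 r i j / (real i - real j)))"
  have v: "order_ge (Suc 0) v" by (simp add: order_ge_1_iff v_def)
  have rot_v: "rotation_deriv v = r"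
    by (intro fps2_eqI) (use r_diag in \<open>auto simp: coeff2_rotation_deriv v_def\<close>)
  define W where "W = fps_at (fps_exp 1) v"
  define V where "V = fps_at (fps_exp (- 1)) v"
  have "fps_exp 1 * fps_exp (- 1) = (1 :: real fps)"
    using fps_exp_add_mult[of "1::real" "- 1"] by simp
  hence WV: "W * V = 1"
    by (simp add: W_def V_def v fps_at_1 flip: fps_at_mult)
  have rot_W: "rotation_deriv W = W * r"
    using rotation_deriv_fps_at[OF v, of "fps_exp 1"] by (simp add: W_def rot_v)
  define Q where "Q = var_q * W"
  define P where "P = var_p * of_product m * V"
  have QP: "Q * P = of_product K"
  proof -
    have "Q * P = (var_q * var_p) * of_product m * (W * V)"
      by (simp add: Q_def P_def mult_ac)
    thus ?thesis by (simp add: WV m(1) of_product_mult of_product_X)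
  qed
  have "Q * bracket Q P = bracket Q (Q * P)"
    by (simp add: bracket_mult_right bracket_self)
  also have "\<dots> = of_product k * rotation_deriv Q"
    by (simp add: QP bracket_of_product K)
  also have "rotation_deriv Q = Q * (1 + r)"
    by (simp add: Q_def rotation_deriv_mult rot_W)
       (simp add: rotation_deriv_def deriv_simps algebra_simps)
  also have "of_product k * (Q * (1 + r)) = Q * g"
    by (simp add: mult_ac flip: r)
  finally have "Q * bracket Q P = Q * g" .
  moreover have W0: "coeff2 W 0 0 = 1" and V0: "coeff2 V 0 0 = 1"
    by (simp_all add: W_def V_def coeff2_fps_at_00)
  have "Q \<noteq> 0" using W0 by (auto simp: Q_def)
  ultimately have "bracket Q P = g" by simp
  moreover have "order_ge (Suc 0 + Suc 0) (var_q * (W - 1))"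
    by (intro order_ge_mult order_ge_var_q) (simp add: order_ge_1_iff W0)
  hence "order_ge 2 (Q - var_q)"
    by (simp add: Q_def algebra_simps numeral_2_eq_2)
  moreover have "order_ge (Suc 0 + Suc 0) (var_p * (of_product m * V - 1))"
    by (intro order_ge_mult order_ge_var_p) (simp add: order_ge_1_iff V0 m coeff2_of_product)
  hence "order_ge 2 (P - var_p)"
    by (simp add: P_def algebra_simps numeral_2_eq_2)
  ultimately show ?thesis using QP K k_def by blast
qed

text \<open>
  The inverse of the map \<open>(Q, P)\<close> that straightens the area form \<open>g dx \<and> dy\<close>. From
  \<open>K(XY) = qp\<close> the product \<open>XY\<close> is \<open>h(qp)\<close> for the compositional inverse \<open>h\<close> of \<open>K\<close>.
\<close>

lemma normalising_coordinates_exist: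
  assumes g: "coeff2 g 0 0 = 1"
  shows "\<exists>X Y h. order_ge (Suc 0) X \<and> order_ge (Suc 0) Y \<and> fps_nth h 1 = 1 \<and>
    X * Y = of_product h \<and> compose2 g X Y * bracket X Y = 1"
proof -
  from straighten_area_form[OF g] obtain Q P K where Q: "order_ge 2 (Q - var_q)"
    and P: "order_ge 2 (P - var_p)" and QP: "bracket Q P = g" "Q * P = of_product K"
    and K: "fps_deriv K = diag g" "fps_nth K 0 = 0" by blast
  from formal_right_inverse[OF Q P] obtain X Y where X: "order_ge (Suc 0) X"
    and Y: "order_ge (Suc 0) Y" and inv: "compose2 Q X Y = var_q" "compose2 P X Y = var_p"
    by blast
  have K1: "fps_nth K 1 = 1"
    using arg_cong[OF K(1), of "\<lambda>F. fps_nth F 0"] g by (simp add: diag_def)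
  define h where "h = fps_inv K"
  have hK: "h oo K = fps_X" using fps_inv[of K] K K1 by (simp add: h_def)
  have "fps_nth (h oo K) 1 = fps_nth h 1" using K1 K by (simp add: fps_compose_nth)
  hence h1: "fps_nth h 1 = 1" by (simp add: hK)
  have XY: "order_ge (Suc 0) (X * Y)" using X by (rule order_ge_mult_right)
  have "fps_at K (X * Y) = var_q * var_p"
    using compose2_mult[OF X Y, of Q P] by (simp add: QP inv compose2_of_product X Y)
  hence "of_product h = fps_at h (fps_at K (X * Y))" by (simp add: of_product_eq_fps_at)
  also have "\<dots> = fps_at fps_X (X * Y)"
    by (simp add: fps_at_compose XY K flip: hK)
  also have "\<dots> = X * Y" by (simp add: fps_at_X XY)
  finally have "X * Y = of_product h" ..
  moreover have "compose2 g X Y * bracket X Y = 1"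
    using bracket_compose2[OF X Y, of Q P] by (simp add: inv QP) (simp add: bracket_def deriv_simps)
  ultimately show ?thesis using X Y h1 by blast
qed

section \<open>Coordinates for the Euler top\<close>

lemma higher_deriv_has_fps_expansion:
  fixes f :: "real \<Rightarrow> real"
  assumes "f has_fps_expansion F"
  shows "(deriv ^^ n) f 0 = fact n * fps_nth F n"
proof -
  have "(deriv ^^ n) f has_fps_expansion (fps_deriv ^^ n) F"
    using assms by (induction n) (auto intro: has_fps_expansion_deriv)
  hence "(deriv ^^ n) f 0 = fps_nth ((fps_deriv ^^ n) F) 0"
    by (auto simp: has_fps_expansion_def eval_fps_at_0 dest: eventually_nhds_x_imp_x)
  thus ?thesis by (simp add: fps_0th_higher_deriv)
qed

text \<open>
  The Hamiltonian is quadratic in \<open>p\<close>, with coefficients that are affine in \<open>sin\<^sup>2 q\<close>; so each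
  iterated derivative comes from two one-variable expansions.
\<close>

lemma taylor2_euler_hamiltonian:
  "taylor2 (euler_hamiltonian \<rho>) =
     scalar (1 / 2) * (- (var_p ^ 2) * (scalar \<rho> + scalar (inverse \<rho>) * lift_q (fps_sin 1) ^ 2)
       + scalar (inverse \<rho>) * lift_q (fps_sin 1) ^ 2)"
proof -
  define c where "c = fps_const (inverse \<rho> / 2) * fps_sin 1 ^ 2"
  define d where "d = fps_const (- \<rho> / 2) - c"
  have c: "(\<lambda>q. inverse \<rho> / 2 * sin q ^ 2) has_fps_expansion c"
    unfolding c_def power2_eq_square by (intro fps_expansion_intros)
  have d: "(\<lambda>q. - \<rho> / 2 - inverse \<rho> / 2 * sin q ^ 2) has_fps_expansion d"
    unfolding d_def by (intro fps_expansion_intros c)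
  have p: "(\<lambda>p. euler_hamiltonian \<rho> q p) has_fps_expansion
      fps_const (inverse \<rho> / 2 * sin q ^ 2) +
      fps_const (- \<rho> / 2 - inverse \<rho> / 2 * sin q ^ 2) * fps_X ^ 2" for q
  proof -
    have "euler_hamiltonian \<rho> q = (\<lambda>p. inverse \<rho> / 2 * sin q ^ 2 +
        (- \<rho> / 2 - inverse \<rho> / 2 * sin q ^ 2) * p ^ 2)"
      by (simp add: euler_hamiltonian_def fun_eq_iff algebra_simps)
    thus ?thesis by (simp only:) (intro fps_expansion_intros)
  qed
  have coeff: "(deriv ^^ i) (\<lambda>q. (deriv ^^ j) (euler_hamiltonian \<rho> q) 0) 0 / (fact i * fact j) =
      (if j = 0 then fps_nth c i else if j = 2 then fps_nth d i else 0)" for i j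
  proof -
    have inner: "(deriv ^^ j) (euler_hamiltonian \<rho> q) 0 = (if j = 0 then inverse \<rho> / 2 * sin q ^ 2
        else if j = 2 then 2 * (- \<rho> / 2 - inverse \<rho> / 2 * sin q ^ 2) else 0)" for q
      by (subst higher_deriv_has_fps_expansion[OF p]) (auto simp: fps_X_power_nth)
    have "(\<lambda>q. 2 * (- \<rho> / 2 - inverse \<rho> / 2 * sin q ^ 2)) has_fps_expansion fps_const 2 * d"
      by (intro fps_expansion_intros d)
    from higher_deriv_has_fps_expansion[OF this] higher_deriv_has_fps_expansion[OF c]
      higher_deriv_has_fps_expansion[OF has_fps_expansion_0]
    show ?thesis unfolding inner by auto
  qed
  have "taylor2 (euler_hamiltonian \<rho>) = lift_q c + lift_q d * var_p ^ 2"
  proof (rule fps2_eqI)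
    fix i j
    have "coeff2 (taylor2 (euler_hamiltonian \<rho>)) i j =
        (if j = 0 then fps_nth c i else if j = 2 then fps_nth d i else 0)"
      by (simp add: taylor2_def coeff)
    also have "\<dots> = coeff2 (lift_q c + lift_q d * var_p ^ 2) i j"
      by (auto simp: coeff2_lift_q fps_const_power fps_X_power_mult_right_nth lift_q_def)
    finally show "coeff2 (taylor2 (euler_hamiltonian \<rho>)) i j =
        coeff2 (lift_q c + lift_q d * var_p ^ 2) i j" .
  qed
  also have "\<dots> = scalar (1 / 2) * (- (var_p ^ 2) *
      (scalar \<rho> + scalar (inverse \<rho>) * lift_q (fps_sin 1) ^ 2) +
      scalar (inverse \<rho>) * lift_q (fps_sin 1) ^ 2)"
  proof -
    have lc: "lift_q c = scalar (1 / 2) * (scalar (inverse \<rho>) * lift_q (fps_sin 1) ^ 2)"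
      by (simp add: c_def lift_q_mult lift_q_power lift_q_const flip: mult.assoc)
    have ld: "lift_q d = - (scalar (1 / 2) * scalar \<rho>) - lift_q c"
      by (simp add: d_def lift_q_diff lift_q_const)
    have "h * (i * s) + (- (h * k) - h * (i * s)) * p = h * (- p * (k + i * s) + i * s)"
      for h i k s p :: "real fps fps"
      by (simp add: algebra_simps)
    thus ?thesis unfolding ld lc .
  qed
  finally show ?thesis .
qed

lemma compose2_lift_q: "compose2 (lift_q c) A B = fps_at c A"
proof (rule fps2_eqI)
  fix m n
  show "coeff2 (compose2 (lift_q c) A B) m n = coeff2 (fps_at c A) m n"
    unfolding fps_at_def compose2_def fps_nth_Abs_fps
    by (intro sum.cong refl) (auto simp: coeff2_lift_q)
qed

lemma fps_sqrt_exists: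
  fixes a :: "real fps"
  assumes "fps_nth a 0 = 1"
  shows "\<exists>s. s ^ 2 = a \<and> fps_nth s 0 = 1"
proof (intro exI conjI)
  show "fps_radical root (Suc 1) a ^ 2 = a"
    using power_radical[of a root 1] assms by (simp add: numeral_2_eq_2)
  show "fps_nth (fps_radical root (Suc 1) a) 0 = 1"
    using assms by (simp add: real_root_one)
qed

text \<open>
  Square roots of series with constant term 1 are unique; this identifies products of square roots
  by their squares.
\<close>

lemma eq_1_if_square_eq_1:
  fixes F :: "real fps fps"
  assumes "F ^ 2 = 1" "coeff2 F 0 0 = 1"
  shows "F = 1"
proof -
  have "F \<noteq> - 1" using assms(2) by auto
  thus ?thesis using assms(1) by (simp add: power2_eq_1_iff)
qed

context
  fixes \<rho> \<kappa> \<tau> :: real and r G :: "real fps"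
  assumes \<rho>: "\<rho> > 0" and \<kappa>: "\<kappa> = \<rho> - inverse \<rho>" and \<tau>: "\<tau> = sqrt (2 * \<rho>)"
    and r: "r ^ 2 = 1 + fps_const (1 / (2 * \<rho>)) * fps_X ^ 2" "fps_nth r 0 = 1"
    and G: "G ^ 2 * (1 - fps_const (\<kappa> / 2) * fps_X ^ 2 - fps_const (1 / 4) * fps_X ^ 4) = 1"
      "fps_nth G 0 = 1"
begin

lemma \<tau>_square: "\<tau> ^ 2 = 2 * \<rho>" and \<tau>_neq_0: "\<tau> \<noteq> 0"
  using \<rho> by (simp_all add: \<tau>)

context
  fixes A B X Y :: "real fps fps"
  assumes A: "order_ge (Suc 0) A" and B: "order_ge (Suc 0) B"
    and X: "order_ge (Suc 0) X" and Y: "order_ge (Suc 0) Y"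
    and sin_A: "fps_at (fps_sin 1) A = scalar (\<tau> / 2) * (X + Y)"
    and B_eq: "scalar \<tau> * fps_at r (X + Y) * B = Y - X"
begin

text \<open>
  The hypotheses \<open>sin_A\<close> and \<open>B_eq\<close> are the explicit coordinate change with \<open>A, B\<close> in the place
  of \<open>q, p\<close>. They are symmetric in the two directions: for uniqueness \<open>X, Y\<close> are computed from
  \<open>A, B\<close>, for existence \<open>A, B\<close> from \<open>X, Y\<close>.
\<close>

lemma order_ge_X_plus_Y: "order_ge (Suc 0) (X + Y)"
  using X Y by (rule order_ge_add)

lemma r_square: "fps_at r (X + Y) ^ 2 = 1 + scalar (1 / (2 * \<rho>)) * (X + Y) ^ 2"
  using arg_cong[OF r(1), of "\<lambda>c. fps_at c (X + Y)"] by (simp add: fps_at_simps order_ge_X_plus_Y)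

lemma sin_square: "fps_at (fps_sin 1) A ^ 2 = scalar (\<rho> / 2) * (X + Y) ^ 2"
  using \<tau>_square by (simp add: sin_A power_mult_distrib fps_const_power power_divide)

text \<open>
  With \<open>z = x + y\<close> one has \<open>\<rho> + sin\<^sup>2 q / \<rho> = \<rho> r(z)\<^sup>2\<close>, so that \<open>H = z\<^sup>2/4 - (\<tau> r(z) p)\<^sup>2/4\<close>,
  which is \<open>((x + y)\<^sup>2 - (y - x)\<^sup>2)/4 = xy\<close>.
\<close>

lemma euler_hamiltonian_eq_product:
  "compose2 (taylor2 (euler_hamiltonian \<rho>)) A B = X * Y"
proof -
  let ?Z = "X + Y"
  have *: "scalar (inverse \<rho>) * fps_at (fps_sin 1) A ^ 2 = scalar (1 / 2) * ?Z ^ 2"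
    using \<rho> by (simp add: sin_square flip: mult.assoc)
  have **: "scalar (1 / 2) * (B ^ 2 * (scalar \<rho> + scalar (1 / 2) * ?Z ^ 2)) =
      scalar (1 / 4) * (scalar \<tau> * fps_at r ?Z * B) ^ 2"
  proof -
    have "scalar (1 / 4) * (scalar \<tau> * fps_at r ?Z * B) ^ 2 =
        (scalar (1 / 4) * scalar \<tau> ^ 2) * (1 + scalar (1 / (2 * \<rho>)) * ?Z ^ 2) * B ^ 2"
      by (simp only: power_mult_distrib r_square mult_ac)
    also have "scalar (1 / 4) * scalar \<tau> ^ 2 = scalar (1 / 2) * scalar \<rho>"
      by (simp add: fps_const_power \<tau>_square)
    also have "scalar (1 / 2) * scalar \<rho> * (1 + scalar (1 / (2 * \<rho>)) * ?Z ^ 2) * B ^ 2 =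
        scalar (1 / 2) * (B ^ 2 * (scalar \<rho> + (scalar \<rho> * scalar (1 / (2 * \<rho>))) * ?Z ^ 2))"
      by (simp only: algebra_simps mult_1_left)
    also have "scalar \<rho> * scalar (1 / (2 * \<rho>)) = scalar (1 / 2)"
      using \<rho> by simp
    finally show ?thesis ..
  qed
  have "compose2 (taylor2 (euler_hamiltonian \<rho>)) A B =
      scalar (1 / 2) * (- (B ^ 2) * (scalar \<rho> + scalar (inverse \<rho>) * fps_at (fps_sin 1) A ^ 2) +
        scalar (inverse \<rho>) * fps_at (fps_sin 1) A ^ 2)"
    by (simp only: taylor2_euler_hamiltonian compose2_lift_q compose2_add compose2_mult[OF A B]
        compose2_minus[OF A B] compose2_power[OF A B] compose2_scalar[OF A B] compose2_var_p[OF A B])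
  also have "\<dots> = (scalar (1 / 2) * scalar (1 / 2)) * ?Z ^ 2 -
      scalar (1 / 2) * (B ^ 2 * (scalar \<rho> + scalar (1 / 2) * ?Z ^ 2))"
  proof -
    have "h * (- b * (k + h * z) + h * z) = h * h * z - h * (b * (k + h * z))"
      for h k z b :: "real fps fps"
      by (simp add: algebra_simps)
    thus ?thesis unfolding * .
  qed
  also have "\<dots> = scalar (1 / 4) * (?Z ^ 2 - (Y - X) ^ 2)"
    unfolding ** B_eq by (simp add: right_diff_distrib)
  also have "?Z ^ 2 - (Y - X) ^ 2 = scalar 4 * (X * Y)"
    by (simp add: power2_eq_square algebra_simps flip: numeral_fps_const)
  also have "scalar (1 / 4) * (scalar 4 * (X * Y)) = X * Y"
    by (simp flip: mult.assoc)
  finally show ?thesis .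
qed

text \<open>
  Bracketing \<open>z = x + y\<close> with \<open>\<tau> r(z) p = y - x\<close> gives \<open>\<tau> r(z) {z,p} = 2 {x,y}\<close>, as \<open>r(z)\<close>
  commutes with \<open>z\<close>, and \<open>\<tau>/2 \<cdot> {z,p} = {sin q, p} = cos q {q,p}\<close>.
\<close>

lemma bracket_X_Y:
  "fps_at (fps_cos 1) A * fps_at r (X + Y) * bracket A B = bracket X Y"
proof -
  let ?Z = "X + Y"
  have sA: "fps_at (fps_cos 1) A * bracket A B = scalar (\<tau> / 2) * bracket ?Z B"
    using bracket_fps_at(1)[OF A, of "fps_sin 1" B]
    by (simp add: sin_A fps_sin_deriv bracket_mult_left bracket_scalar)
  have "scalar \<tau> * (fps_at r ?Z * bracket ?Z B) = bracket ?Z (scalar \<tau> * fps_at r ?Z * B)"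
    by (simp add: bracket_mult_right bracket_scalar bracket_fps_at(2)[OF order_ge_X_plus_Y] bracket_self mult.assoc)
  also have "\<dots> = scalar 2 * bracket X Y"
    by (simp add: B_eq bracket_simps bracket_swap[of Y X] flip: numeral_fps_const)
  finally have *: "scalar \<tau> * (fps_at r ?Z * bracket ?Z B) = scalar 2 * bracket X Y" .
  have "scalar 2 * (fps_at (fps_cos 1) A * fps_at r ?Z * bracket A B) =
      scalar 2 * fps_at r ?Z * (fps_at (fps_cos 1) A * bracket A B)"
    by (simp only: mult_ac)
  also have "\<dots> = (scalar 2 * scalar (\<tau> / 2)) * (fps_at r ?Z * bracket ?Z B)"
    unfolding sA by (simp only: mult_ac)
  also have "scalar 2 * scalar (\<tau> / 2) = scalar \<tau>" by simp
  also note *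
  finally show ?thesis by simp
qed

text \<open>
  The Jacobian \<open>cos q \<cdot> r(z)\<close> is the inverse of \<open>G(z)\<close>: its square is
  \<open>(1 - \<rho>z\<^sup>2/2)(1 + z\<^sup>2/(2\<rho>)) = 1 - \<kappa>z\<^sup>2/2 - z^4/4\<close>.
\<close>

lemma bracket_A_B: "bracket A B = fps_at G (X + Y) * bracket X Y"
proof -
  let ?Z = "X + Y" and ?C = "fps_at (fps_cos 1) A"
  have "?C ^ 2 + fps_at (fps_sin 1) A ^ 2 = 1"
    using arg_cong[OF fps_sin_cos_sum_of_squares[of "1::real"], of "\<lambda>c. fps_at c A"]
    by (simp add: fps_at_simps A)
  hence C: "?C ^ 2 = 1 - scalar (\<rho> / 2) * ?Z ^ 2"
    by (simp add: sin_square algebra_simps)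
  have "?C ^ 2 * fps_at r ?Z ^ 2 =
      1 - (scalar (\<rho> / 2) - scalar (1 / (2 * \<rho>))) * ?Z ^ 2
        - (scalar (\<rho> / 2) * scalar (1 / (2 * \<rho>))) * ?Z ^ 4"
  proof -
    have "(1 - a * z ^ 2) * (1 + b * z ^ 2) = 1 - (a - b) * z ^ 2 - (a * b) * z ^ 4"
      for a b z :: "real fps fps"
      by (simp add: algebra_simps power4_eq_xxxx power2_eq_square)
    thus ?thesis unfolding C r_square .
  qed
  also have "scalar (\<rho> / 2) - scalar (1 / (2 * \<rho>)) = scalar (\<kappa> / 2)"
    by (simp add: \<kappa> field_simps)
  also have "scalar (\<rho> / 2) * scalar (1 / (2 * \<rho>)) = scalar (1 / 4)"
    using \<rho> by simp
  finally have CR: "?C ^ 2 * fps_at r ?Z ^ 2 =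
      1 - scalar (\<kappa> / 2) * ?Z ^ 2 - scalar (1 / 4) * ?Z ^ 4" .
  have "(?C * fps_at r ?Z * fps_at G ?Z) ^ 2 = fps_at G ?Z ^ 2 * (?C ^ 2 * fps_at r ?Z ^ 2)"
    by (simp only: power_mult_distrib mult_ac)
  also have "\<dots> = 1"
    unfolding CR using arg_cong[OF G(1), of "\<lambda>c. fps_at c ?Z"]
    by (simp add: fps_at_simps order_ge_X_plus_Y)
  finally have "?C * fps_at r ?Z * fps_at G ?Z = 1"
    by (rule eq_1_if_square_eq_1) (simp add: coeff2_fps_at_00 r G)
  hence "bracket A B = fps_at G ?Z * (?C * fps_at r ?Z * bracket A B)"
    by (metis mult.assoc mult.commute mult_1)
  thus ?thesis by (simp only: bracket_X_Y)
qed

end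

lemma fps_at_G_compose2:
  assumes "order_ge (Suc 0) X" "order_ge (Suc 0) Y"
  shows "compose2 (fps_at G (var_q + var_p)) X Y = fps_at G (X + Y)"
  using assms
  by (simp add: compose2_fps_at order_ge_add order_ge_var_q order_ge_var_p compose2_simps)

lemma formal_symplectic_iff:
  "formal_symplectic A B \<longleftrightarrow>
     order_ge (Suc 0) A \<and> order_ge (Suc 0) B \<and> bracket A B = 1"
  by (simp add: formal_symplectic_def bracket_def order_ge_1_iff)

lemma birkhoff_normal_form_eq_fps_inv:
  assumes "birkhoff_normal_form (euler_hamiltonian \<rho>) h"
    and K: "fps_deriv K = diag (fps_at G (var_q + var_p))" "fps_nth K 0 = 0"
  shows "h = fps_inv K"
proof -
  from assms obtain A B where A: "order_ge (Suc 0) A" and B: "order_ge (Suc 0) B"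
    and AB: "bracket A B = 1" and nf: "compose2 (taylor2 (euler_hamiltonian \<rho>)) A B = of_product h"
    and h1: "fps_nth h 1 = 1"
    by (auto simp: birkhoff_normal_form_def formal_symplectic_iff)
  define Z where "Z = scalar (2 / \<tau>) * fps_at (fps_sin 1) A"
  define D where "D = scalar \<tau> * fps_at r Z * B"
  define X where "X = scalar (1 / 2) * (Z - D)"
  define Y where "Y = scalar (1 / 2) * (Z + D)"
  have "order_ge (Suc 0) Z"
    unfolding Z_def by (intro order_ge_mult_left order_ge_fps_at) simp
  moreover have "order_ge (Suc 0) D"
    unfolding D_def by (intro order_ge_mult_left B)
  ultimately have X: "order_ge (Suc 0) X" and Y: "order_ge (Suc 0) Y"
    by (simp_all only: X_def Y_def order_ge_mult_left order_ge_add order_ge_diff)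
  have half: "scalar (1 / 2) * F + scalar (1 / 2) * F = F" for F
    by (simp flip: distrib_right)
  have "X + Y = Z" "Y - X = D"
    using half[of Z] half[of D] by (simp_all add: X_def Y_def algebra_simps)
  moreover have "fps_at (fps_sin 1) A = scalar (\<tau> / 2) * Z"
    using \<tau>_neq_0 by (simp add: Z_def flip: mult.assoc)
  ultimately have sin: "fps_at (fps_sin 1) A = scalar (\<tau> / 2) * (X + Y)"
    and B_eq: "scalar \<tau> * fps_at r (X + Y) * B = Y - X"
    by (simp_all add: D_def)
  have XY: "X * Y = of_product h"
    using euler_hamiltonian_eq_product[OF A B X Y sin B_eq] nf by simp
  have g: "compose2 (fps_at G (var_q + var_p)) X Y * bracket X Y = 1"
    using bracket_A_B[OF A B X Y sin B_eq] AB by (simp add: fps_at_G_compose2 X Y)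
  moreover have "coeff2 (bracket X Y) 0 0 = 1"
    using arg_cong[OF g, of "\<lambda>F. coeff2 F 0 0"] by (simp add: coeff2_compose2_00 coeff2_fps_at_00 G X Y)
  ultimately show ?thesis
    using normalised_eq_fps_inv[OF X Y XY h1 _ _ K] by blast
qed

lemma birkhoff_normal_form_exists: "\<exists>h. birkhoff_normal_form (euler_hamiltonian \<rho>) h"
proof -
  have "coeff2 (fps_at G (var_q + var_p)) 0 0 = 1" by (simp add: coeff2_fps_at_00 G)
  from normalising_coordinates_exist[OF this] obtain X Y h
    where X: "order_ge (Suc 0) X" and Y: "order_ge (Suc 0) Y" and h1: "fps_nth h 1 = 1"
      and XY: "X * Y = of_product h"
      and g: "compose2 (fps_at G (var_q + var_p)) X Y * bracket X Y = 1" by blast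
  define W where "W = scalar (\<tau> / 2) * (X + Y)"
  have W: "order_ge (Suc 0) W"
    unfolding W_def by (intro order_ge_mult_left order_ge_add X Y)
  define A where "A = fps_at (fps_inv (fps_sin 1)) W"
  define B where "B = scalar (1 / \<tau>) * fps_at (inverse r) (X + Y) * (Y - X)"
  have inv0: "fps_nth (fps_inv (fps_sin 1)) 0 = (0 :: real)" by (simp add: fps_inv_def)
  have A: "order_ge (Suc 0) A"
    unfolding A_def by (intro order_ge_fps_at inv0)
  have B: "order_ge (Suc 0) B"
    unfolding B_def by (intro order_ge_mult_left order_ge_diff X Y)
  have sin: "fps_at (fps_sin 1) A = scalar (\<tau> / 2) * (X + Y)"
    by (simp add: A_def W inv0 fps_inv_right fps_at_X W_def[symmetric] flip: fps_at_compose)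
  have "fps_at r (X + Y) * fps_at (inverse r) (X + Y) = 1"
    using r by (simp add: inverse_mult_eq_1' order_ge_add X Y fps_at_1 flip: fps_at_mult)
  moreover have "scalar \<tau> * scalar (1 / \<tau>) = 1"
    using \<tau>_neq_0 by simp
  moreover have "scalar \<tau> * fps_at r (X + Y) * B =
      (scalar \<tau> * scalar (1 / \<tau>)) * (fps_at r (X + Y) * fps_at (inverse r) (X + Y)) * (Y - X)"
    by (simp only: B_def mult_ac)
  ultimately have B_eq: "scalar \<tau> * fps_at r (X + Y) * B = Y - X" by (simp only: mult_1_left)
  have "compose2 (taylor2 (euler_hamiltonian \<rho>)) A B = of_product h"
    using euler_hamiltonian_eq_product[OF A B X Y sin B_eq] XY by simp
  moreover have "bracket A B = 1"
    using bracket_A_B[OF A B X Y sin B_eq] g by (simp add: fps_at_G_compose2 X Y)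
  ultimately have "birkhoff_normal_form (euler_hamiltonian \<rho>) h"
    unfolding birkhoff_normal_form_def formal_symplectic_iff using A B h1 by blast
  thus ?thesis ..
qed

end

section \<open>The first coefficients\<close>

lemma coeff2_power_q_plus_p:
  "coeff2 ((var_q + var_p) ^ k) m n = (if k = m + n then real (k choose m) else 0)"
proof -
  have "(var_q + var_p) ^ k = (\<Sum>i\<le>k. monom2 (real (k choose i)) i (k - i))"
    unfolding binomial_ring by (intro sum.cong refl) (simp add: monom2_def fps_of_nat)
  hence "coeff2 ((var_q + var_p) ^ k) m n =
      (\<Sum>i\<le>k. if m = i then if n = k - m then real (k choose m) else 0 else 0)"
    by (simp only: coeff2_sum coeff2_monom2) (intro sum.cong refl, auto)
  thus ?thesis by auto
qed

lemma diag_fps_at_q_plus_p: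
  "fps_nth (diag (fps_at G (var_q + var_p))) n = fps_nth G (2 * n) * real (2 * n choose n)"
proof -
  have "fps_nth (diag (fps_at G (var_q + var_p))) n =
    (\<Sum>i\<le>n+n. \<Sum>j\<le>n+n. if j = 0 then if i = n + n then fps_nth G i * real (i choose n) else 0 else 0)"
    unfolding diag_def fps_at_def compose2_def fps_nth_Abs_fps
    by (intro sum.cong refl) (auto simp: coeff2_lift_q coeff2_power_q_plus_p)
  also have "\<dots> = fps_nth G (2 * n) * real (2 * n choose n)"
    by (simp add: mult_2)
  finally show ?thesis .
qed

text \<open>
  \<open>G = S^(-1/2)\<close> solves \<open>2 S G' = - S' G\<close>, which is a recursion for its coefficients.
\<close>

lemma inverse_sqrt_coeffs:
  fixes G :: "real fps" and \<kappa> :: real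
  assumes G: "G ^ 2 * (1 - fps_const (\<kappa> / 2) * fps_X ^ 2 - fps_const (1 / 4) * fps_X ^ 4) = 1"
    "fps_nth G 0 = 1"
  shows "fps_nth G 2 = \<kappa> / 4"
    "fps_nth G 4 = (3 * \<kappa>^2 + 4) / 32"
    "fps_nth G 6 = (5 * \<kappa>^3 + 12 * \<kappa>) / 128"
    "fps_nth G 8 = (35 * \<kappa>^4 + 120 * \<kappa>^2 + 48) / 2048"
    "fps_nth G 10 = (63 * \<kappa>^5 + 280 * \<kappa>^3 + 240 * \<kappa>) / 8192"
    "fps_nth G 12 = (231 * \<kappa>^6 + 1260 * \<kappa>^4 + 1680 * \<kappa>^2 + 320) / 65536"
proof -
  define S where "S = 1 - fps_const (\<kappa> / 2) * fps_X ^ 2 - fps_const (1 / 4) * fps_X ^ 4"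
  have S': "fps_deriv S = - (fps_const \<kappa> * fps_X) - fps_X ^ 3"
    by (rule fps_ext) (auto simp: S_def fps_X_power_nth fps_X_nth)
  have "G * (2 * fps_deriv G * S + G * fps_deriv S) = fps_deriv (G ^ 2 * S)"
    by (simp add: power2_eq_square algebra_simps)
  also have "\<dots> = 0" using G by (simp add: S_def)
  finally have "2 * fps_deriv G * S = - G * fps_deriv S"
    using G(2) by (auto simp: eq_neg_iff_add_eq_0)
  hence ode: "2 * (fps_deriv G - fps_const (\<kappa> / 2) * (fps_deriv G * fps_X ^ 2)
      - fps_const (1 / 4) * (fps_deriv G * fps_X ^ 4)) =
      fps_const \<kappa> * (G * fps_X) + G * fps_X ^ 3"
    by (simp add: S_def[symmetric] S') (simp add: S_def algebra_simps)
  have two: "fps_nth (2 * F) n = 2 * fps_nth F n" for F :: "real fps" and n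
    by (simp add: numeral_fps_const)
  have rec: "2 * (real (n + 1) * fps_nth G (n + 1)
       - \<kappa> / 2 * (if n < 2 then 0 else real (n - 2 + 1) * fps_nth G (n - 2 + 1))
       - 1 / 4 * (if n < 4 then 0 else real (n - 4 + 1) * fps_nth G (n - 4 + 1))) =
      \<kappa> * (if n = 0 then 0 else fps_nth G (n - 1)) + (if n < 3 then 0 else fps_nth G (n - 3))" for n
    using arg_cong[OF ode, of "\<lambda>F. fps_nth F n"]
    by (simp only: two fps_sub_nth fps_add_nth fps_mult_left_const_nth
        fps_X_mult_right_nth fps_X_power_mult_right_nth fps_deriv_nth of_nat_id)
  show 2: "fps_nth G 2 = \<kappa> / 4"
    using rec[of 1] G(2) by (simp add: numeral_2_eq_2)
  show 4: "fps_nth G 4 = (3 * \<kappa>^2 + 4) / 32"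
    using rec[of 3] 2 2[unfolded numeral_2_eq_2] G(2) by (simp add: field_simps power_numeral_reduce[of \<kappa>])
  show 6: "fps_nth G 6 = (5 * \<kappa>^3 + 12 * \<kappa>) / 128"
    using rec[of 5] 4 2 2[unfolded numeral_2_eq_2] by (simp add: field_simps power_numeral_reduce[of \<kappa>])
  show 8: "fps_nth G 8 = (35 * \<kappa>^4 + 120 * \<kappa>^2 + 48) / 2048"
    using rec[of 7] 6 4 by (simp add: field_simps power_numeral_reduce[of \<kappa>])
  show 10: "fps_nth G 10 = (63 * \<kappa>^5 + 280 * \<kappa>^3 + 240 * \<kappa>) / 8192"
    using rec[of 9] 8 6 by (simp add: field_simps power_numeral_reduce[of \<kappa>])
  show 12: "fps_nth G 12 = (231 * \<kappa>^6 + 1260 * \<kappa>^4 + 1680 * \<kappa>^2 + 320) / 65536"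
    using rec[of 11] 10 8 by (simp add: field_simps power_numeral_reduce[of \<kappa>])
qed

text \<open>
  The coefficient of \<open>X^n\<close> in \<open>h(X u)\<close> is \<open>\<Sum>i\<le>n. h\<^sub>i [u^i]\<^bsub>n - i\<^esub>\<close>, with last term \<open>h\<^sub>n\<close>; so the
  coefficients of \<open>h\<close> are found one after the other from those of the powers of \<open>u\<close>. The given
  values are those of \<open>u = K(E)/E\<close> for the action \<open>K\<close> of the Euler top.
\<close>

lemma power_series_inverse_coeffs:
  fixes h u :: "real fps" and \<kappa> :: real
  assumes inv: "h oo (fps_X * u) = fps_X"
    and u: "fps_nth u 0 = 1" "fps_nth u 1 = \<kappa> / 4"
       "fps_nth u 2 = (3 * \<kappa>^2 + 4) / 16"
       "fps_nth u 3 = (25 * \<kappa>^3 + 60 * \<kappa>) / 128"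
       "fps_nth u 4 = (245 * \<kappa>^4 + 840 * \<kappa>^2 + 336) / 1024"
       "fps_nth u 5 = (1323 * \<kappa>^5 + 5880 * \<kappa>^3 + 5040 * \<kappa>) / 4096"
       "fps_nth u 6 = (7623 * \<kappa>^6 + 41580 * \<kappa>^4 + 55440 * \<kappa>^2 + 10560) / 16384"
  shows "fps_nth h 0 = 0" "fps_nth h 1 = 1"
    "fps_nth h 2 = - (\<kappa> / 4)"
    "fps_nth h 3 = - ((\<kappa>^2 + 4) / 16)"
    "fps_nth h 4 = - (5 * \<kappa> * (\<kappa>^2 + 4) / 128)"
    "fps_nth h 5 = - (3 * (\<kappa>^2 + 4) * (11 * \<kappa>^2 + 12) / 1024)"
    "fps_nth h 6 = - (7 * \<kappa> * (\<kappa>^2 + 4) * (9 * \<kappa>^2 + 20) / 2048)"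
    "fps_nth h 7 = - ((\<kappa>^2 + 4) * (527 * \<kappa>^4 + 1776 * \<kappa>^2 + 720) / 16384)"
proof -
  have mult_nth: "fps_nth (u ^ j) n = (\<Sum>k\<le>n. fps_nth (u ^ i) k * fps_nth u (n - k))"
    if "j = i + 1" for i j n
    by (simp only: that Suc_eq_plus1[symmetric] power_Suc2 fps_mult_nth atLeast0AtMost)
  note normalise = field_simps power_numeral_reduce[of \<kappa>]
  note expand = atMost_nat_numeral atMost_Suc u u[unfolded One_nat_def]
  have u2_0: "fps_nth (u ^ 2) 0 = 1"
    using mult_nth[of 2 1 0]
    by (simp add: expand normalise)
  have u2_1: "fps_nth (u ^ 2) 1 = \<kappa> / 2"
    using mult_nth[of 2 1 1]
    by (simp add: expand normalise)
  have u2_2: "fps_nth (u ^ 2) 2 = (7 * \<kappa>^2 + 8) / 16"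
    using mult_nth[of 2 1 2]
    by (simp add: expand normalise)
  have u2_3: "fps_nth (u ^ 2) 3 = (31 * \<kappa>^3 + 68 * \<kappa>) / 64"
    using mult_nth[of 2 1 3]
    by (simp add: expand normalise)
  have u2_4: "fps_nth (u ^ 2) 4 = (313 * \<kappa>^4 + 1008 * \<kappa>^2 + 368) / 512"
    using mult_nth[of 2 1 4]
    by (simp add: expand normalise)
  have u2_5: "fps_nth (u ^ 2) 5 = (859 * \<kappa>^5 + 3640 * \<kappa>^3 + 2928 * \<kappa>) / 1024"
    using mult_nth[of 2 1 5]
    by (simp add: expand normalise)
  have u3_0: "fps_nth (u ^ 3) 0 = 1"
    using mult_nth[of 3 2 0]
    by (simp add: expand u2_0 normalise)
  have u3_1: "fps_nth (u ^ 3) 1 = 3 * \<kappa> / 4"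
    using mult_nth[of 3 2 1]
    by (simp add: expand u2_0 u2_1 u2_1[unfolded One_nat_def] normalise)
  have u3_2: "fps_nth (u ^ 3) 2 = (3 * \<kappa>^2 + 3) / 4"
    using mult_nth[of 3 2 2]
    by (simp add: expand u2_0 u2_1 u2_1[unfolded One_nat_def] u2_2 normalise)
  have u3_3: "fps_nth (u ^ 3) 3 = (113 * \<kappa>^3 + 228 * \<kappa>) / 128"
    using mult_nth[of 3 2 3]
    by (simp add: expand u2_0 u2_1 u2_1[unfolded One_nat_def] u2_2 u2_3 normalise)
  have u3_4: "fps_nth (u ^ 3) 4 = (1179 * \<kappa>^4 + 3576 * \<kappa>^2 + 1200) / 1024"
    using mult_nth[of 3 2 4]
    by (simp add: expand u2_0 u2_1 u2_1[unfolded One_nat_def] u2_2 u2_3 u2_4 normalise)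
  have u4_0: "fps_nth (u ^ 4) 0 = 1"
    using mult_nth[of 4 3 0]
    by (simp add: expand u3_0 normalise)
  have u4_1: "fps_nth (u ^ 4) 1 = \<kappa>"
    using mult_nth[of 4 3 1]
    by (simp add: expand u3_0 u3_1 u3_1[unfolded One_nat_def] normalise)
  have u4_2: "fps_nth (u ^ 4) 2 = (9 * \<kappa>^2 + 8) / 8"
    using mult_nth[of 4 3 2]
    by (simp add: expand u3_0 u3_1 u3_1[unfolded One_nat_def] u3_2 normalise)
  have u4_3: "fps_nth (u ^ 4) 3 = (45 * \<kappa>^3 + 84 * \<kappa>) / 32"
    using mult_nth[of 4 3 3]
    by (simp add: expand u3_0 u3_1 u3_1[unfolded One_nat_def] u3_2 u3_3 normalise)
  have u5_0: "fps_nth (u ^ 5) 0 = 1"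
    using mult_nth[of 5 4 0]
    by (simp add: expand u4_0 normalise)
  have u5_1: "fps_nth (u ^ 5) 1 = 5 * \<kappa> / 4"
    using mult_nth[of 5 4 1]
    by (simp add: expand u4_0 u4_1 u4_1[unfolded One_nat_def] normalise)
  have u5_2: "fps_nth (u ^ 5) 2 = (25 * \<kappa>^2 + 20) / 16"
    using mult_nth[of 5 4 2]
    by (simp add: expand u4_0 u4_1 u4_1[unfolded One_nat_def] u4_2 normalise)
  have u6_0: "fps_nth (u ^ 6) 0 = 1"
    using mult_nth[of 6 5 0]
    by (simp add: expand u5_0 normalise)
  have u6_1: "fps_nth (u ^ 6) 1 = 3 * \<kappa> / 2"
    using mult_nth[of 6 5 1]
    by (simp add: expand u5_0 u5_1 u5_1[unfolded One_nat_def] normalise)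
  have u7_0: "fps_nth (u ^ 7) 0 = 1"
    using mult_nth[of 7 6 0]
    by (simp add: expand u6_0 normalise)
  have coeff: "(\<Sum>i\<le>n. fps_nth h i * fps_nth (u ^ i) (n - i)) = (if n = 1 then 1 else 0)" for n
  proof -
    have "fps_nth ((fps_X * u) ^ i) n = fps_nth (u ^ i) (n - i)" if "i \<le> n" for i
      using that by (simp add: power_mult_distrib fps_X_power_mult_nth)
    hence "fps_nth (h oo (fps_X * u)) n = (\<Sum>i\<le>n. fps_nth h i * fps_nth (u ^ i) (n - i))"
      by (simp add: fps_compose_nth atLeast0AtMost)
    thus ?thesis unfolding inv by (simp add: fps_X_nth split: if_splits)
  qed
  show h0: "fps_nth h 0 = 0" using coeff[of 0] by simp
  show h1: "fps_nth h 1 = 1" using coeff[of 1] h0 u by simp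
  show h2: "fps_nth h 2 = - (\<kappa> / 4)"
    using coeff[of 2]
    by (simp add: expand h0 h1 h1[unfolded One_nat_def] u2_0 normalise)
  show h3: "fps_nth h 3 = - ((\<kappa>^2 + 4) / 16)"
    using coeff[of 3]
    by (simp add: expand h0 h1 h2 h1[unfolded One_nat_def] u2_1 u2_1[unfolded One_nat_def] u3_0 normalise)
  show h4: "fps_nth h 4 = - (5 * \<kappa> * (\<kappa>^2 + 4) / 128)"
    using coeff[of 4]
    by (simp add: expand h0 h1 h2 h3 h1[unfolded One_nat_def] u2_2 u3_1 u3_1[unfolded One_nat_def] u4_0 normalise)
  show h5: "fps_nth h 5 = - (3 * (\<kappa>^2 + 4) * (11 * \<kappa>^2 + 12) / 1024)"
    using coeff[of 5]
    by (simp add: expand h0 h1 h2 h3 h4 h1[unfolded One_nat_def] u2_3 u3_2 u4_1 u4_1[unfolded One_nat_def] u5_0 normalise)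
  show h6: "fps_nth h 6 = - (7 * \<kappa> * (\<kappa>^2 + 4) * (9 * \<kappa>^2 + 20) / 2048)"
    using coeff[of 6]
    by (simp add: expand h0 h1 h2 h3 h4 h5 h1[unfolded One_nat_def] u2_4 u3_3 u4_2 u5_1 u5_1[unfolded One_nat_def] u6_0 normalise)
  show h7: "fps_nth h 7 = - ((\<kappa>^2 + 4) * (527 * \<kappa>^4 + 1776 * \<kappa>^2 + 720) / 16384)"
    using coeff[of 7]
    by (simp add: expand h0 h1 h2 h3 h4 h5 h6 h1[unfolded One_nat_def] u2_5 u3_4 u4_3 u5_2 u6_1 u6_1[unfolded One_nat_def] u7_0 normalise)
qed

lemma fps_eq_plus_X_power_mult:
  fixes f g :: "'a :: comm_ring_1 fps"
  assumes "\<And>i. i < n \<Longrightarrow> fps_nth f i = fps_nth g i"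
  shows "\<exists>R. f = g + fps_X ^ n * R"
proof (intro exI fps_ext)
  fix i
  show "fps_nth f i = fps_nth (g + fps_X ^ n * fps_shift n (f - g)) i"
    using assms[of i] by (simp add: fps_X_power_mult_nth)
qed

theorem theorem2p4:
  fixes \<Theta>1 \<Theta>2 \<Theta>3 \<rho> \<kappa> :: real
  assumes "0 < \<Theta>1" and "\<Theta>1 < \<Theta>2" and "\<Theta>2 < \<Theta>3"
    and "\<Theta>1 \<le> \<Theta>2 + \<Theta>3" and "\<Theta>2 \<le> \<Theta>1 + \<Theta>3" and "\<Theta>3 \<le> \<Theta>1 + \<Theta>2"
    and "\<rho> = euler_rho \<Theta>1 \<Theta>2 \<Theta>3"
    and "\<kappa> = \<rho> - inverse \<rho>"
  shows "(\<exists>!h. birkhoff_normal_form (euler_hamiltonian \<rho>) h) \<and>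
    (\<forall>h. birkhoff_normal_form (euler_hamiltonian \<rho>) h \<longrightarrow>
      (\<exists>R :: real fps. h =
          fps_X
        - fps_const (\<kappa> / 4) * fps_X^2
        - fps_const ((\<kappa>^2 + 4) / 16) * fps_X^3
        - fps_const (5 * \<kappa> * (\<kappa>^2 + 4) / 128) * fps_X^4
        - fps_const (3 * (\<kappa>^2 + 4) * (11 * \<kappa>^2 + 12) / 1024) * fps_X^5
        - fps_const (7 * \<kappa> * (\<kappa>^2 + 4) * (9 * \<kappa>^2 + 20) / 2048) * fps_X^6
        - fps_const ((\<kappa>^2 + 4) * (527 * \<kappa>^4 + 1776 * \<kappa>^2 + 720) / 16384) * fps_X^7
        + fps_X^8 * R))"
proof -
  have \<rho>: "\<rho> > 0"
    using assms by (simp add: euler_rho_def)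
  obtain r :: "real fps" where r: "r ^ 2 = 1 + fps_const (1 / (2 * \<rho>)) * fps_X ^ 2" "fps_nth r 0 = 1"
    using fps_sqrt_exists[of "1 + fps_const (1 / (2 * \<rho>)) * fps_X ^ 2"] by auto
  define S where "S = 1 - fps_const (\<kappa> / 2) * fps_X ^ 2 - fps_const (1 / 4) * fps_X ^ 4"
  obtain s :: "real fps" where s: "s ^ 2 = S" "fps_nth s 0 = 1"
    using fps_sqrt_exists[of S] by (auto simp: S_def)
  define G where "G = inverse s"
  have "G ^ 2 * S = (G * s) ^ 2" by (simp add: power_mult_distrib s)
  also have "G * s = 1" using s by (simp add: G_def inverse_mult_eq_1)
  finally have G: "G ^ 2 * (1 - fps_const (\<kappa> / 2) * fps_X ^ 2 - fps_const (1 / 4) * fps_X ^ 4) = 1"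
    by (simp add: S_def)
  have G0: "fps_nth G 0 = 1" using s by (simp add: G_def)
  define K where "K = fps_integral0 (diag (fps_at G (var_q + var_p)))"
  have K: "fps_deriv K = diag (fps_at G (var_q + var_p))" "fps_nth K 0 = 0"
    by (simp_all add: K_def fps_deriv_fps_integral)
  note euler = \<rho> assms(8) refl r G G0
  have unique: "h = fps_inv K" if "birkhoff_normal_form (euler_hamiltonian \<rho>) h" for h
    by (rule birkhoff_normal_form_eq_fps_inv[OF euler that K])
  \<comment> \<open>The inverse is computed for \<open>K = X u\<close>, since \<open>u\<close> has constant term 1.\<close>
  define u where "u = fps_shift 1 K"
  have K_u: "K = fps_X * u"
    using K by (auto simp: u_def fps_eq_iff fps_X_mult_nth)
  have u_nth: "fps_nth u n = fps_nth G (2 * n) * real (2 * n choose n) / (real n + 1)" for n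
    by (simp add: u_def K_def fps_integral_def diag_fps_at_q_plus_p field_simps)
  have choose: "(2 choose 1) = (2::nat)" "(4 choose 2) = (6::nat)" "(6 choose 3) = (20::nat)"
    "(8 choose 4) = (70::nat)" "(10 choose 5) = (252::nat)" "(12 choose 6) = (924::nat)"
    by (simp_all add: eval_nat_numeral)
  note G_coeffs = inverse_sqrt_coeffs[OF G G0]
  have u: "fps_nth u 0 = 1" "fps_nth u 1 = \<kappa> / 4"
     "fps_nth u 2 = (3 * \<kappa>^2 + 4) / 16"
     "fps_nth u 3 = (25 * \<kappa>^3 + 60 * \<kappa>) / 128"
     "fps_nth u 4 = (245 * \<kappa>^4 + 840 * \<kappa>^2 + 336) / 1024"
     "fps_nth u 5 = (1323 * \<kappa>^5 + 5880 * \<kappa>^3 + 5040 * \<kappa>) / 4096"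
     "fps_nth u 6 = (7623 * \<kappa>^6 + 41580 * \<kappa>^4 + 55440 * \<kappa>^2 + 10560) / 16384"
    by (simp_all add: u_nth G0 G_coeffs G_coeffs(1)[unfolded numeral_2_eq_2] choose field_simps)
  have "fps_inv K oo K = fps_X"
    by (rule fps_inv) (use K u in \<open>simp_all add: K_u\<close>)
  hence coeffs: "fps_inv K oo (fps_X * u) = fps_X" by (simp flip: K_u)
  note h_nth = power_series_inverse_coeffs[OF coeffs u]
  define P where "P = fps_X
        - fps_const (\<kappa> / 4) * fps_X^2
        - fps_const ((\<kappa>^2 + 4) / 16) * fps_X^3
        - fps_const (5 * \<kappa> * (\<kappa>^2 + 4) / 128) * fps_X^4
        - fps_const (3 * (\<kappa>^2 + 4) * (11 * \<kappa>^2 + 12) / 1024) * fps_X^5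
        - fps_const (7 * \<kappa> * (\<kappa>^2 + 4) * (9 * \<kappa>^2 + 20) / 2048) * fps_X^6
        - fps_const ((\<kappa>^2 + 4) * (527 * \<kappa>^4 + 1776 * \<kappa>^2 + 720) / 16384) * fps_X^7"
  have "fps_nth (fps_inv K) i = fps_nth P i" if "i < 8" for i
  proof -
    from that consider "i = 0" | "i = 1" | "i = 2" | "i = 3" | "i = 4" | "i = 5" | "i = 6" | "i = 7"
      by linarith
    thus ?thesis by cases (simp_all add: P_def h_nth h_nth(2)[unfolded One_nat_def] fps_X_power_nth fps_X_nth)
  qed
  from fps_eq_plus_X_power_mult[OF this] have "\<exists>R. fps_inv K = P + fps_X ^ 8 * R" .
  with unique birkhoff_normal_form_exists[OF euler] show ?thesis
    unfolding P_def by blast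
qed

end
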